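(* In the faulty RAM (FRAM) model, there exists a randomized in-place resilient selection algorithm with expected time complexity $O(n+\alpha)$, where $n$ is the size of the input array and $\alpha$ is the number of corruptions that occur during the execution.
   Context: FRAM model: memory cells may be corrupted (their contents changed arbitrarily, adversarially) at any time during the execution of an algorithm, the same cell possibly several times, and the algorithm cannot distinguish corrupted from uncorrupted cells. There are $O(1)$ reliable memory cells that are never corrupted. An upper bound $\delta$ on the number of corruptions is given to the algorithm; $\alpha\le\delta$ denotes the actual number of corruptions during the execution. A memory cell holds $\Theta(\log n)$ bits. A randomized algorithm may toss random coins; the corruptions are still adversarial but the adversary cannot see the algorithm's coins, and the algorithm must be correct with probability $1$ regardless of the coin outcomes. In-place means using $O(1)$ space besides the input array. For an array $X$ and element $e$, $\mathrm{rank}_X(e)=|\{i: X[i]\le e\}|$, and the $\alpha$-rank of $k$ in $X$ is $\{e : \mathrm{rank}_X(e)\in[k-\alpha,k+\alpha]\}$. A resilient selection algorithm is given an array $X$ of size $n$ and an integer $k$ and returns an element $e$ in the $\alpha$-rank of $k$ in $X^0$, where $X^0$ is the state of $X$ at the start of the execution and $\alpha$ the number of corruptions during the execution.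
   Formalization: For arrays with repeated entries the literal α-rank can be empty (X=[5,5], k=1, α=0), so there the returned e is only required to satisfy rank(e) ≥ k−α and (number of entries less than e)+1 ≤ k+α; for distinct entries the literal α-rank is required. *)

theory Defs
  imports "HOL-Probability.Probability" "HOL-Library.Landau_Symbols"
begin

section \<open>A faulty random access machine\<close>

text \<open>
  Registers are named directly in the program text, which is a finite list not depending on
  the input. Hence a program uses a constant number of registers; these, the program itself and
  the program counter form the reliable memory. All other memory is unreliable and is
  reached only by \<open>Load\<close> and \<open>Store\<close>, whose address operands are registers.
\<close>

datatype binop = Plus | Minus | Times | Div | Mod

datatype instr =
    Const nat nat
  | Op binop nat nat nat
  | Load nat nat
  | Store nat nat
  | Jump nat
  | JumpLess nat nat nat
  | Toss nat
  | Halt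

record config =
  pc :: nat
  regs :: "nat \<Rightarrow> nat"
  mem :: "nat \<Rightarrow> nat"

text \<open>Subtraction is truncated; all results are reduced to words of \<open>w\<close> bits.\<close>

fun apply_op :: "binop \<Rightarrow> nat \<Rightarrow> nat \<Rightarrow> nat" where
  "apply_op Plus x y = x + y"
| "apply_op Minus x y = x - y"
| "apply_op Times x y = x * y"
| "apply_op Div x y = x div y"
| "apply_op Mod x y = x mod y"

definition set_reg :: "nat \<Rightarrow> nat \<Rightarrow> nat \<Rightarrow> config \<Rightarrow> config" where
  "set_reg w r v s = s\<lparr>pc := Suc (pc s), regs := (regs s)(r := v mod 2 ^ w)\<rparr>"

fun exec :: "nat \<Rightarrow> bool \<Rightarrow> instr \<Rightarrow> config \<Rightarrow> config" where
  "exec w b (Const r v) s = set_reg w r v s"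
| "exec w b (Op f r x y) s = set_reg w r (apply_op f (regs s x) (regs s y)) s"
| "exec w b (Load r x) s = set_reg w r (mem s (regs s x)) s"
| "exec w b (Store x r) s =
     s\<lparr>pc := Suc (pc s), mem := (mem s)(regs s x := regs s r)\<rparr>"
| "exec w b (Jump l) s = s\<lparr>pc := l\<rparr>"
| "exec w b (JumpLess x y l) s =
     s\<lparr>pc := (if regs s x < regs s y then l else Suc (pc s))\<rparr>"
| "exec w b (Toss r) s = set_reg w r (of_bool b) s"
| "exec w b Halt s = s"

fun accessed :: "instr \<Rightarrow> config \<Rightarrow> nat set" where
  "accessed (Load r x) s = {regs s x}"
| "accessed (Store x r) s = {regs s x}"
| "accessed _ s = {}"

definition halted :: "instr list \<Rightarrow> config \<Rightarrow> bool" where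
  "halted P s \<longleftrightarrow> length P \<le> pc s \<or> P ! pc s = Halt"

text \<open>
  An adversary assigns to every time and address either \<open>None\<close> or the word that this
  cell is corrupted to, immediately before the instruction at that time is executed. It is a
  function of time only, chosen without knowledge of the coins (but possibly with knowledge of
  the program and its input). Every pair of a time and an address with an entry is one
  corruption, whether or not the new word happens to differ from the old one.
\<close>

type_synonym adversary = "nat \<Rightarrow> nat \<Rightarrow> nat option"

definition corruption_events :: "adversary \<Rightarrow> (nat \<times> nat) set" where
  "corruption_events adv = {(t, a). adv t a \<noteq> None}"

definition valid_adversary :: "nat \<Rightarrow> nat \<Rightarrow> adversary \<Rightarrow> bool" where
  "valid_adversary w \<delta> adv \<longleftrightarrow>
     finite (corruption_events adv) \<and> card (corruption_events adv) \<le> \<delta> \<and>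
     (\<forall>t a v. adv t a = Some v \<longrightarrow> v < 2 ^ w)"

definition corrupt :: "(nat \<Rightarrow> nat option) \<Rightarrow> config \<Rightarrow> config" where
  "corrupt c s = s\<lparr>mem := (\<lambda>a. case c a of None \<Rightarrow> mem s a | Some v \<Rightarrow> v)\<rparr>"

text \<open>The coin used by a \<open>Toss\<close> executed at time \<open>t\<close> is \<open>\<omega> t\<close>; a halted configuration stays put.\<close>

primrec run ::
  "nat \<Rightarrow> instr list \<Rightarrow> adversary \<Rightarrow> (nat \<Rightarrow> bool) \<Rightarrow> config \<Rightarrow> nat \<Rightarrow> config"
where
  "run w P adv \<omega> s 0 = s"
| "run w P adv \<omega> s (Suc t) =
     (let s' = run w P adv \<omega> s t
      in if halted P s' then s' else exec w (\<omega> t) (P ! pc s') (corrupt (adv t) s'))"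

text \<open>Number of executed instructions, \<open>\<infinity>\<close> for a diverging run.\<close>

definition run_time ::
  "nat \<Rightarrow> instr list \<Rightarrow> adversary \<Rightarrow> config \<Rightarrow> (nat \<Rightarrow> bool) \<Rightarrow> enat"
where
  "run_time w P adv s \<omega> = (INF t\<in>{t. halted P (run w P adv \<omega> s t)}. enat t)"

definition num_corruptions ::
  "nat \<Rightarrow> instr list \<Rightarrow> adversary \<Rightarrow> config \<Rightarrow> (nat \<Rightarrow> bool) \<Rightarrow> nat"
where
  "num_corruptions w P adv s \<omega> =
     card {(t, a) \<in> corruption_events adv. enat t < run_time w P adv s \<omega>}"

definition coin_space :: "(nat \<Rightarrow> bool) measure" where
  "coin_space = PiM UNIV (\<lambda>_. measure_pmf (bernoulli_pmf (1 / 2)))"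

section \<open>Resilient selection\<close>

definition rank :: "'a::linorder list \<Rightarrow> 'a \<Rightarrow> nat" where
  "rank X e = card {i. i < length X \<and> X ! i \<le> e}"

definition strict_rank :: "'a::linorder list \<Rightarrow> 'a \<Rightarrow> nat" where
  "strict_rank X e = card {i. i < length X \<and> X ! i < e}"

definition alpha_rank :: "nat \<Rightarrow> 'a::linorder list \<Rightarrow> nat \<Rightarrow> 'a set" where
  "alpha_rank \<alpha> X k = {e. int (rank X e) \<in> {int k - int \<alpha> .. int k + int \<alpha>}}"

text \<open>
  If entries repeat, \<open>alpha_rank \<alpha> X k\<close> can be empty (no element of \<open>[5, 5]\<close> has rank 1). An
  entry \<open>e\<close> then occupies all ranks in \<open>{strict_rank X e + 1 .. rank X e}\<close>, and
  one of them has to be in the window around \<open>k\<close>.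
\<close>

definition selects :: "nat \<Rightarrow> 'a::linorder list \<Rightarrow> nat \<Rightarrow> 'a \<Rightarrow> bool" where
  "selects \<alpha> X k e \<longleftrightarrow>
     (if distinct X then e \<in> alpha_rank \<alpha> X k
      else int k - int \<alpha> \<le> int (rank X e) \<and> int (strict_rank X e) + 1 \<le> int k + int \<alpha>)"

text \<open>
  The array occupies addresses \<open>0, \<dots>, n - 1\<close>; the remaining cells initially hold arbitrary
  words. Registers 0, 1, 2 receive \<open>n\<close>, \<open>k\<close> and \<open>\<delta>\<close>. A bound \<open>\<delta>\<close> that does not fit into a word is
  passed as the largest word.
\<close>

definition initial :: "nat \<Rightarrow> nat \<Rightarrow> nat \<Rightarrow> nat \<Rightarrow> (nat \<Rightarrow> nat) \<Rightarrow> config" where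
  "initial w n k \<delta> M =
     \<lparr>pc = 0, regs = (\<lambda>_. 0)(0 := n, 1 := k, 2 := min \<delta> (2 ^ w - 1)), mem = M\<rparr>"

definition input_array :: "nat \<Rightarrow> (nat \<Rightarrow> nat) \<Rightarrow> nat list" where
  "input_array n M = map M [0..<n]"

definition valid_instance ::
  "nat \<Rightarrow> nat \<Rightarrow> nat \<Rightarrow> nat \<Rightarrow> (nat \<Rightarrow> nat) \<Rightarrow> adversary \<Rightarrow> bool"
where
  "valid_instance w n k \<delta> M adv \<longleftrightarrow>
     1 \<le> k \<and> k \<le> n \<and> (\<forall>a. M a < 2 ^ w) \<and> valid_adversary w \<delta> adv"

text \<open>
  The word length \<open>w\<close> is a function of the array size. The result is returned in register 0.
  Returned answers are correct for every outcome of the coins; termination is almost sure.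
\<close>

definition resilient_selection :: "(nat \<Rightarrow> nat) \<Rightarrow> instr list \<Rightarrow> bool" where
  "resilient_selection w P \<longleftrightarrow>
     (\<forall>n k \<delta> M adv. valid_instance (w n) n k \<delta> M adv \<longrightarrow>
        (let s = initial (w n) n k \<delta> M in
           (AE \<omega> in coin_space. \<exists>t. halted P (run (w n) P adv \<omega> s t)) \<and>
           (\<forall>\<omega> t. halted P (run (w n) P adv \<omega> s t) \<longrightarrow>
              selects (num_corruptions (w n) P adv s \<omega>) (input_array n M) k
                (regs (run (w n) P adv \<omega> s t) 0))))"

definition in_place :: "(nat \<Rightarrow> nat) \<Rightarrow> instr list \<Rightarrow> bool" where
  "in_place w P \<longleftrightarrow>
     (\<exists>c. \<forall>n k \<delta> M adv \<omega> t. valid_instance (w n) n k \<delta> M adv \<longrightarrow>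
        (let s = run (w n) P adv \<omega> (initial (w n) n k \<delta> M) t in
           \<not> halted P s \<longrightarrow> accessed (P ! pc s) s \<subseteq> {..<n + c}))"

text \<open>
  The number of corruptions during the execution depends on the coins through the
  length of the run, so the time bound refers to its expectation.
\<close>

definition expected_time ::
  "nat \<Rightarrow> instr list \<Rightarrow> adversary \<Rightarrow> config \<Rightarrow> ennreal"
where
  "expected_time w P adv s =
     (\<integral>\<^sup>+\<omega>. ennreal_of_enat (run_time w P adv s \<omega>) \<partial>coin_space)"

definition expected_corruptions ::
  "nat \<Rightarrow> instr list \<Rightarrow> adversary \<Rightarrow> config \<Rightarrow> ennreal"
where
  "expected_corruptions w P adv s =
     (\<integral>\<^sup>+\<omega>. of_nat (num_corruptions w P adv s \<omega>) \<partial>coin_space)"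

end

theory Submission
  imports Defs "HOL-Library.Log_Nat"
begin

text \<open>
  The program is quickselect on a segment \<open>{..<m}\<close> of the memory, with an interval of values kept in
  registers to which the result is confined. Each round draws a random pivot. If the pivot lies in
  the interval, a first scan counts the entries below and at most the pivot, and the pivot is either
  returned or becomes a new end of the interval. A second scan discards all entries outside the
  interval. If the entries left can no longer contain the one of rank \<open>k\<close>, an end of the interval is
  returned. The result need not be an entry of the array; only its rank matters, and a
  corruption shifts the number of entries below any threshold by at most one.

  For the running time, a potential proportional to the size of the segment pays for the scans, as a
  random pivot removes a constant fraction of the segment on average. A corruption raises the
  potential by a constant at most. The only exception is the time between tossing the coins for a
  pivot and reading it, when corrupting the chosen cell could spoil the round. There the potential is
  defined by the memory at the time of reading, which is independent of these coins because
  the adversary is oblivious and because the number of steps until then is not random.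
\<close>

section \<open>Runs\<close>

text \<open>Nothing read from memory has to be genuine. A pivot is only a threshold whose rank is
  counted, and all counters and loop bounds are reliable, so the slack \<open>\<alpha>\<close> of
  the rank window absorbs the shifted counts. After corruptions the counts may contradict each
  other, up to an empty segment; the bounds that the invariant keeps on the ranks of both interval
  ends then make one of these ends a valid answer. The constants come from counting instructions. A
  digit of the random index takes 5, an entry at most 7 in either scan, so a round on
  \<open>m\<close> entries costs at most \<open>14 * m + 5 * bits m\<close> plus a constant. The
  larger side of a pivot has at most \<open>15 / 16 * m\<close> entries on average, so the weight
  1024 per entry releases \<open>64 * m\<close> in a round, which suffices even for
  \<open>m = 1\<close>. The same 1024 pays for a corruption, as it adds at most one entry to a
  count. The setup takes 3 instructions per bit of a word, hence linear time for words of
  logarithmic length.\<close>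

definition coin :: "bool measure" where
  "coin = measure_pmf (bernoulli_pmf (1 / 2))"

section \<open>Independence of a single coin\<close>

lemma nn_integral_coin: "(\<integral>\<^sup>+b. f b \<partial>coin) = f True / 2 + f False / 2"
proof -
  have "ennreal (1 / 2) = 1 / 2"
    by (metis divide_ennreal ennreal_1 ennreal_numeral zero_le_one zero_less_numeral)
  then show ?thesis
    by (simp add: coin_def ennreal_times_divide)
qed

lemma nn_integral_coin_space_split:
  assumes [measurable]: "f \<in> borel_measurable coin_space"
  shows "(\<integral>\<^sup>+\<omega>. f \<omega> \<partial>coin_space) =
    (\<integral>\<^sup>+\<omega>. f (fun_upd \<omega> t True) / 2 + f (fun_upd \<omega> t False) / 2 \<partial>PiM (UNIV - {t}) (\<lambda>_. coin))"
proof -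
  let ?I = "UNIV - {t}" and ?N = "PiM (UNIV - {t}) (\<lambda>_. coin)"
  have prob: "prob_space coin"
    by (simp add: coin_def measure_pmf.prob_space_axioms)
  interpret sigma_finite_measure ?N
    by (intro prob_space_imp_sigma_finite prob_space_PiM prob)
  interpret C: prob_space coin by (rule prob)
  interpret pair_sigma_finite coin ?N ..
  have eq: "coin_space = PiM (insert t ?I) (\<lambda>_. coin)"
    by (simp add: coin_space_def coin_def insert_absorb)
  have d: "distr (coin \<Otimes>\<^sub>M ?N) coin_space (\<lambda>(x, X). X(t := x)) = coin_space"
    unfolding eq by (rule distr_pair_PiM_eq_PiM) (use prob in auto)
  have m[measurable]: "(\<lambda>(x, X). X(t := x)) \<in> measurable (coin \<Otimes>\<^sub>M ?N) coin_space"
    unfolding eq by measurable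
  have "(\<integral>\<^sup>+\<omega>. f \<omega> \<partial>coin_space) = (\<integral>\<^sup>+\<omega>. f \<omega> \<partial>distr (coin \<Otimes>\<^sub>M ?N) coin_space (\<lambda>(x, X). X(t := x)))"
    by (simp add: d)
  also have "\<dots> = (\<integral>\<^sup>+z. f ((\<lambda>(x, X). X(t := x)) z) \<partial>(coin \<Otimes>\<^sub>M ?N))"
    by (rule nn_integral_distr) measurable
  also have "\<dots> = (\<integral>\<^sup>+X. \<integral>\<^sup>+x. f (X(t := x)) \<partial>coin \<partial>?N)"
    by (subst nn_integral_snd[symmetric]) (auto simp: case_prod_unfold)
  finally show ?thesis by (simp add: nn_integral_coin)
qed

lemma run_fun_upd: "t' \<le> t \<Longrightarrow> run w P adv (fun_upd \<omega> t b) s t' = run w P adv \<omega> s t'"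
  by (induction t') (auto simp: Let_def)

lemma measurable_coin [measurable]: "(\<lambda>\<omega>. \<omega> t) \<in> measurable coin_space (count_space UNIV)"
  unfolding coin_space_def by (measurable; simp)

text \<open>Configurations form an uncountable type, yet every set of them yields an event: each
  step branches on one coin with two outcomes, so the state at time \<open>t\<close> is a function
  of finitely many coins.\<close>

lemma measurable_run [measurable]:
  "(\<lambda>\<omega>. run w P adv \<omega> s t) \<in> measurable coin_space (count_space UNIV)"
proof (induction t)
  case (Suc t)
  define g where "g b c = (if halted P c then c else exec w b (P ! pc c) (corrupt (adv t) c))" for b c
  have "(\<lambda>\<omega>. g (\<omega> t) (run w P adv \<omega> s t)) \<in> measurable coin_space (count_space UNIV)"
    by (rule measurable_compose_countable[where f = "\<lambda>b \<omega>. g b (run w P adv \<omega> s t)"])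
      (use Suc measurable_coin in \<open>auto intro: measurable_compose\<close>)
  then show ?case by (simp add: g_def Let_def)
qed simp

text \<open>The state at time \<open>t\<close> depends on earlier coins only, so coin
  \<open>t\<close> is still fair given that state. With coin \<open>t\<close> split off, both sides
  become the same integral over the other coins.\<close>

lemma nn_integral_next_coin:
  fixes g :: "bool \<Rightarrow> config \<Rightarrow> ennreal"
  shows "(\<integral>\<^sup>+\<omega>. g (\<omega> t) (run w P adv \<omega> s t) \<partial>coin_space) =
    (\<integral>\<^sup>+\<omega>. g True (run w P adv \<omega> s t) / 2 + g False (run w P adv \<omega> s t) / 2 \<partial>coin_space)"
proof -
  have halves: "x / 2 + x / 2 = x" for x :: ennreal
  proof -
    have "x / 2 + x / 2 = (x * 2) / 2"
      by (simp add: add_divide_distrib_ennreal mult_2_right)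
    then show ?thesis by (simp add: mult_divide_eq_ennreal)
  qed
  have m: "(\<lambda>\<omega>. h (run w P adv \<omega> s t)) \<in> borel_measurable coin_space" for h :: "config \<Rightarrow> ennreal"
    by (rule measurable_compose[OF measurable_run]) simp
  have m': "(\<lambda>\<omega>. g (\<omega> t) (run w P adv \<omega> s t)) \<in> borel_measurable coin_space"
    by (rule measurable_compose_countable[where f = "\<lambda>b \<omega>. g b (run w P adv \<omega> s t)"])
      (use m measurable_coin in auto)
  show ?thesis
    by (subst (1 2) nn_integral_coin_space_split[where t = t])
      (use m' m in \<open>auto simp: run_fun_upd halves\<close>)
qed

section \<open>Halting time and number of corruptions as series over time\<close>

lemma run_halted:
  assumes "halted P (run w P adv \<omega> s t)" "t \<le> t'"
  shows "run w P adv \<omega> s t' = run w P adv \<omega> s t"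
  using assms(2,1) by (induction t' rule: dec_induct) (auto simp: Let_def)

lemma less_run_time_iff:
  "enat t < run_time w P adv s \<omega> \<longleftrightarrow> \<not> halted P (run w P adv \<omega> s t)"
proof
  assume "enat t < run_time w P adv s \<omega>"
  then show "\<not> halted P (run w P adv \<omega> s t)"
    unfolding run_time_def
    using INF_lower[of t "{t. halted P (run w P adv \<omega> s t)}" enat] by auto
next
  assume nh: "\<not> halted P (run w P adv \<omega> s t)"
  have "enat (Suc t) \<le> run_time w P adv s \<omega>"
    unfolding run_time_def
  proof (rule INF_greatest)
    fix t' assume "t' \<in> {t. halted P (run w P adv \<omega> s t)}"
    with nh have "\<not> t' \<le> t" using run_halted[of P w adv \<omega> s t' t] by auto
    then show "enat (Suc t) \<le> enat t'" by simp
  qed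
  then show "enat t < run_time w P adv s \<omega>"
    by (simp add: Suc_ile_eq)
qed

text \<open>The tail sum makes the expected running time a series of probabilities of not having
  halted, to be compared with the potential step by step.\<close>

lemma ennreal_of_enat_eq_suminf: "ennreal_of_enat x = (\<Sum>t. of_bool (enat t < x))"
proof (cases x)
  case (enat m)
  then have "(\<Sum>t. of_bool (enat t < x) :: ennreal) = (\<Sum>t\<in>{..<m}. of_bool (enat t < x))"
    by (intro suminf_finite) auto
  then show ?thesis using enat by simp
next
  case infinity
  have "(\<Sum>t. 1 :: ennreal) = \<infinity>"
  proof -
    have "of_nat N \<le> (\<Sum>t. 1 :: ennreal)" for N
      using sum_le_suminf[of "\<lambda>_. 1 :: ennreal" "{..<N}"] by simp
    then have "(SUP N. of_nat N) \<le> (\<Sum>t. 1 :: ennreal)"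
      by (rule SUP_least)
    then show ?thesis
      by (simp add: ennreal_SUP_of_nat_eq_top top_unique)
  qed
  with infinity show ?thesis by simp
qed

definition corruptions :: "adversary \<Rightarrow> nat \<Rightarrow> nat" where
  "corruptions adv t = card (dom (adv t))"

lemma finite_dom_adversary:
  assumes "finite (corruption_events adv)"
  shows "finite (dom (adv t))"
proof -
  have "dom (adv t) \<subseteq> snd ` corruption_events adv"
    by (force simp: corruption_events_def image_iff)
  then show ?thesis using assms finite_surj by blast
qed

lemma card_corruption_events:
  assumes fin: "finite (corruption_events adv)" and T: "finite T"
  shows "card {(t, a) \<in> corruption_events adv. t \<in> T} = (\<Sum>t\<in>T. corruptions adv t)"
proof -
  have "{(t, a) \<in> corruption_events adv. t \<in> T} = (SIGMA t:T. dom (adv t))"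
    by (auto simp: corruption_events_def)
  then show ?thesis
    using T finite_dom_adversary[OF fin] by (simp add: corruptions_def)
qed

lemma of_nat_num_corruptions:
  assumes fin: "finite (corruption_events adv)"
  shows "(of_nat (num_corruptions w P adv s \<omega>) :: ennreal) =
    (\<Sum>t. of_bool (\<not> halted P (run w P adv \<omega> s t)) * of_nat (corruptions adv t))"
proof -
  define T where "T = {t \<in> fst ` corruption_events adv. \<not> halted P (run w P adv \<omega> s t)}"
  have T: "finite T" using fin by (simp add: T_def)
  have "{(t, a) \<in> corruption_events adv. enat t < run_time w P adv s \<omega>} =
      {(t, a) \<in> corruption_events adv. t \<in> T}"
    by (force simp: T_def less_run_time_iff)
  then have "num_corruptions w P adv s \<omega> = (\<Sum>t\<in>T. corruptions adv t)"
    using card_corruption_events[OF fin T] by (simp add: num_corruptions_def)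
  moreover have "(\<Sum>t. of_bool (\<not> halted P (run w P adv \<omega> s t)) * of_nat (corruptions adv t)) =
      (\<Sum>t\<in>T. of_bool (\<not> halted P (run w P adv \<omega> s t)) * of_nat (corruptions adv t) :: ennreal)"
  proof (rule suminf_finite[OF T])
    fix t assume "t \<notin> T"
    then have "halted P (run w P adv \<omega> s t) \<or> dom (adv t) = {}"
      by (force simp: T_def corruption_events_def image_iff)
    then show "of_bool (\<not> halted P (run w P adv \<omega> s t)) * of_nat (corruptions adv t) = (0 :: ennreal)"
      by (auto simp: corruptions_def)
  qed
  ultimately show ?thesis by (simp add: T_def)
qed

lemma num_corruptions_halted:
  assumes fin: "finite (corruption_events adv)"
    and nh: "\<And>t'. t' < t \<Longrightarrow> \<not> halted P (run w P adv \<omega> s t')" and h: "halted P (run w P adv \<omega> s t)"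
  shows "num_corruptions w P adv s \<omega> = (\<Sum>t'<t. corruptions adv t')"
proof -
  have "enat t' < run_time w P adv s \<omega> \<longleftrightarrow> t' \<in> {..<t}" for t'
    using nh[of t'] h run_halted[of P w adv \<omega> s t t'] by (force simp: less_run_time_iff not_less)
  then show ?thesis
    using card_corruption_events[OF fin, of "{..<t}"] by (simp add: num_corruptions_def)
qed

text \<open>
  The expected potential decreases by one in every step, except that every corruption may
  raise it by \<open>C\<close>; summing over all steps bounds the expected running time.
\<close>

theorem expected_time_le_potential:
  fixes \<Phi> :: "nat \<Rightarrow> config \<Rightarrow> real" and C :: nat
  assumes fin: "finite (corruption_events adv)"
    and nonneg: "\<And>t \<omega>. 0 \<le> \<Phi> t (run w P adv \<omega> s t)"
    and halt: "\<And>t \<omega>. halted P (run w P adv \<omega> s t) \<Longrightarrow> \<Phi> (Suc t) (run w P adv \<omega> s t) \<le> \<Phi> t (run w P adv \<omega> s t)"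
    and drift: "\<And>t \<omega>. let c = run w P adv \<omega> s t; c' = (\<lambda>b. exec w b (P ! pc c) (corrupt (adv t) c)) in
      \<not> halted P c \<longrightarrow> 1 + (\<Phi> (Suc t) (c' True) + \<Phi> (Suc t) (c' False)) / 2 \<le> \<Phi> t c + C * corruptions adv t"
  shows "expected_time w P adv s \<le> ennreal (\<Phi> 0 s) + of_nat C * expected_corruptions w P adv s"
proof -
  define R where "R t \<omega> = run w P adv \<omega> s t" for t \<omega>
  define H where "H t \<omega> = (of_bool (\<not> halted P (R t \<omega>)) :: ennreal)" for t \<omega>
  define F where "F t = (\<integral>\<^sup>+\<omega>. ennreal (\<Phi> t (R t \<omega>)) \<partial>coin_space)" for t
  have meas: "(\<lambda>\<omega>. h (R t \<omega>)) \<in> borel_measurable coin_space" for h :: "config \<Rightarrow> ennreal" and t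
    unfolding R_def by (rule measurable_compose[OF measurable_run]) simp
  have H[measurable]: "H t \<in> borel_measurable coin_space" for t
    unfolding H_def by (rule meas)
  interpret prob_space coin_space
    unfolding coin_space_def by (intro prob_space_PiM measure_pmf.prob_space_axioms)
  define g where "g t b c = (if halted P c then \<Phi> (Suc t) c
      else \<Phi> (Suc t) (exec w b (P ! pc c) (corrupt (adv t) c)))" for t b c
  have R_Suc: "ennreal (\<Phi> (Suc t) (R (Suc t) \<omega>)) = ennreal (g t (\<omega> t) (R t \<omega>))" for t \<omega>
    by (simp add: R_def g_def Let_def)
  \<comment> \<open>\<open>nonneg\<close> speaks only of states of runs; the successor under the
    other coin belongs to the run with coin \<open>t\<close> flipped.\<close>
  have g_nonneg: "0 \<le> g t b (R t \<omega>)" for t b \<omega>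
    using nonneg[of "Suc t" "fun_upd \<omega> t b"] by (simp add: g_def R_def run_fun_upd Let_def split: if_splits)
  have step: "F (Suc t) + (\<integral>\<^sup>+\<omega>. H t \<omega> \<partial>coin_space)
      \<le> F t + of_nat C * (\<integral>\<^sup>+\<omega>. H t \<omega> * of_nat (corruptions adv t) \<partial>coin_space)" for t
  proof -
    have "F (Suc t) = (\<integral>\<^sup>+\<omega>. ennreal (g t True (R t \<omega>)) / 2 + ennreal (g t False (R t \<omega>)) / 2 \<partial>coin_space)"
      unfolding F_def R_Suc unfolding R_def by (rule nn_integral_next_coin)
    also have "\<dots> = (\<integral>\<^sup>+\<omega>. ennreal ((g t True (R t \<omega>) + g t False (R t \<omega>)) / 2) \<partial>coin_space)"
    proof (rule nn_integral_cong)
      fix \<omega>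
      have "ennreal x / 2 + ennreal y / 2 = ennreal ((x + y) / 2)" if "0 \<le> x" "0 \<le> y" for x y
        using that ennreal_divide_numeral[of x "num.Bit0 num.One"] ennreal_divide_numeral[of y "num.Bit0 num.One"]
        by (simp add: add_divide_distrib flip: ennreal_plus)
      then show "ennreal (g t True (R t \<omega>)) / 2 + ennreal (g t False (R t \<omega>)) / 2 =
          ennreal ((g t True (R t \<omega>) + g t False (R t \<omega>)) / 2)"
        using g_nonneg by blast
    qed
    finally have "F (Suc t) + (\<integral>\<^sup>+\<omega>. H t \<omega> \<partial>coin_space) =
        (\<integral>\<^sup>+\<omega>. ennreal ((g t True (R t \<omega>) + g t False (R t \<omega>)) / 2) + H t \<omega> \<partial>coin_space)"
      by (subst nn_integral_add) (auto intro: meas)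
    also have "\<dots> \<le> (\<integral>\<^sup>+\<omega>. ennreal (\<Phi> t (R t \<omega>)) + of_nat C * (H t \<omega> * of_nat (corruptions adv t)) \<partial>coin_space)"
    proof (rule nn_integral_mono)
      fix \<omega>
      show "ennreal ((g t True (R t \<omega>) + g t False (R t \<omega>)) / 2) + H t \<omega>
          \<le> ennreal (\<Phi> t (R t \<omega>)) + of_nat C * (H t \<omega> * of_nat (corruptions adv t))"
      proof (cases "halted P (R t \<omega>)")
        case True
        then show ?thesis
          using halt[where t = t and \<omega> = \<omega>] by (simp add: H_def g_def ennreal_leI flip: R_def)
      next
        case False
        have "(g t True (R t \<omega>) + g t False (R t \<omega>)) / 2 + 1 \<le> \<Phi> t (R t \<omega>) + C * corruptions adv t"
          using drift[where t = t and \<omega> = \<omega>] False by (simp add: Let_def g_def add.commute flip: R_def)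
        then have "ennreal ((g t True (R t \<omega>) + g t False (R t \<omega>)) / 2 + 1)
            \<le> ennreal (\<Phi> t (R t \<omega>) + C * corruptions adv t)"
          by (rule ennreal_leI)
        also have "\<dots> = ennreal (\<Phi> t (R t \<omega>)) + of_nat C * of_nat (corruptions adv t)"
          using nonneg[of t \<omega>] by (simp add: R_def ennreal_mult ennreal_of_nat_eq_real_of_nat)
        finally show ?thesis
          using g_nonneg[of t True \<omega>] g_nonneg[of t False \<omega>] False by (simp add: H_def)
      qed
    qed
    also have "\<dots> = F t + of_nat C * (\<integral>\<^sup>+\<omega>. H t \<omega> * of_nat (corruptions adv t) \<partial>coin_space)"
      unfolding F_def by (subst nn_integral_add) (auto intro: meas simp: nn_integral_cmult)
    finally show ?thesis .
  qed
  \<comment> \<open>Telescoping. \<open>F N\<close> stays on the left, since \<open>ennreal\<close>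
    does not allow cancelling infinite values.\<close>
  have sums: "F N + (\<Sum>t<N. \<integral>\<^sup>+\<omega>. H t \<omega> \<partial>coin_space)
      \<le> F 0 + of_nat C * (\<Sum>t<N. \<integral>\<^sup>+\<omega>. H t \<omega> * of_nat (corruptions adv t) \<partial>coin_space)" for N
  proof (induction N)
    case (Suc N)
    have "F (Suc N) + (\<Sum>t<Suc N. \<integral>\<^sup>+\<omega>. H t \<omega> \<partial>coin_space) =
        F (Suc N) + (\<integral>\<^sup>+\<omega>. H N \<omega> \<partial>coin_space) + (\<Sum>t<N. \<integral>\<^sup>+\<omega>. H t \<omega> \<partial>coin_space)"
      by (simp add: algebra_simps)
    also have "\<dots> \<le> F N + of_nat C * (\<integral>\<^sup>+\<omega>. H N \<omega> * of_nat (corruptions adv N) \<partial>coin_space)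
        + (\<Sum>t<N. \<integral>\<^sup>+\<omega>. H t \<omega> \<partial>coin_space)"
      by (intro add_right_mono step)
    also have "\<dots> = (F N + (\<Sum>t<N. \<integral>\<^sup>+\<omega>. H t \<omega> \<partial>coin_space))
        + of_nat C * (\<integral>\<^sup>+\<omega>. H N \<omega> * of_nat (corruptions adv N) \<partial>coin_space)"
      by (simp add: algebra_simps)
    also have "\<dots> \<le> F 0 + of_nat C * (\<Sum>t<N. \<integral>\<^sup>+\<omega>. H t \<omega> * of_nat (corruptions adv t) \<partial>coin_space)
        + of_nat C * (\<integral>\<^sup>+\<omega>. H N \<omega> * of_nat (corruptions adv N) \<partial>coin_space)"
      by (intro add_right_mono Suc)
    finally show ?case by (simp add: algebra_simps)
  qed simp
  have "(\<Sum>t. \<integral>\<^sup>+\<omega>. H t \<omega> \<partial>coin_space)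
      \<le> F 0 + of_nat C * (\<Sum>t. \<integral>\<^sup>+\<omega>. H t \<omega> * of_nat (corruptions adv t) \<partial>coin_space)"
  proof (rule suminf_le_const)
    fix N
    have "(\<Sum>t<N. \<integral>\<^sup>+\<omega>. H t \<omega> \<partial>coin_space) \<le> F N + (\<Sum>t<N. \<integral>\<^sup>+\<omega>. H t \<omega> \<partial>coin_space)"
      by simp
    also have "\<dots> \<le> F 0 + of_nat C * (\<Sum>t<N. \<integral>\<^sup>+\<omega>. H t \<omega> * of_nat (corruptions adv t) \<partial>coin_space)"
      by (rule sums)
    also have "\<dots> \<le> F 0 + of_nat C * (\<Sum>t. \<integral>\<^sup>+\<omega>. H t \<omega> * of_nat (corruptions adv t) \<partial>coin_space)"
      by (intro add_left_mono mult_left_mono sum_le_suminf) auto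
    finally show "(\<Sum>t<N. \<integral>\<^sup>+\<omega>. H t \<omega> \<partial>coin_space)
        \<le> F 0 + of_nat C * (\<Sum>t. \<integral>\<^sup>+\<omega>. H t \<omega> * of_nat (corruptions adv t) \<partial>coin_space)" .
  qed simp
  moreover have "F 0 = ennreal (\<Phi> 0 s)"
    by (simp add: F_def R_def emeasure_space_1)
  moreover have "expected_time w P adv s = (\<Sum>t. \<integral>\<^sup>+\<omega>. H t \<omega> \<partial>coin_space)"
    by (simp add: expected_time_def ennreal_of_enat_eq_suminf less_run_time_iff
        nn_integral_suminf flip: H_def R_def)
  moreover have "expected_corruptions w P adv s =
      (\<Sum>t. \<integral>\<^sup>+\<omega>. H t \<omega> * of_nat (corruptions adv t) \<partial>coin_space)"
    by (simp add: expected_corruptions_def of_nat_num_corruptions[OF fin]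
        nn_integral_suminf flip: H_def R_def)
  ultimately show ?thesis by simp
qed

lemma AE_halts:
  assumes "expected_time w P adv s < \<infinity>"
  shows "AE \<omega> in coin_space. \<exists>t. halted P (run w P adv \<omega> s t)"
proof -
  have "(\<lambda>\<omega>. (\<Sum>t. of_bool (\<not> halted P (run w P adv \<omega> s t)) :: ennreal)) \<in> borel_measurable coin_space"
    by (intro borel_measurable_suminf_order measurable_compose[OF measurable_run]) simp
  then have "(\<lambda>\<omega>. ennreal_of_enat (run_time w P adv s \<omega>)) \<in> borel_measurable coin_space"
    by (simp add: ennreal_of_enat_eq_suminf less_run_time_iff)
  then have "AE \<omega> in coin_space. ennreal_of_enat (run_time w P adv s \<omega>) \<noteq> \<infinity>"
    using assms unfolding expected_time_def by (intro nn_integral_PInf_AE) auto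
  then show ?thesis
  proof eventually_elim
    case (elim \<omega>)
    show ?case
    proof (rule ccontr)
      assume "\<nexists>t. halted P (run w P adv \<omega> s t)"
      then have "run_time w P adv s \<omega> = \<infinity>"
        by (simp add: run_time_def top_enat_def)
      with elim show False by simp
    qed
  qed
qed

section \<open>Counting array entries\<close>

definition count_in :: "('a \<Rightarrow> bool) \<Rightarrow> (nat \<Rightarrow> 'a) \<Rightarrow> nat set \<Rightarrow> nat" where
  "count_in Q A S = card {x \<in> S. Q (A x)}"

lemma count_in_empty [simp]: "count_in Q A {} = 0"
  by (simp add: count_in_def)

lemma count_in_insert [simp]:
  assumes "finite S" "a \<notin> S"
  shows "count_in Q A (insert a S) = of_bool (Q (A a)) + count_in Q A S"
proof -
  have "{x \<in> insert a S. Q (A x)} = (if Q (A a) then insert a {x \<in> S. Q (A x)} else {x \<in> S. Q (A x)})"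
    by auto
  then show ?thesis using assms by (simp add: count_in_def)
qed

lemma count_in_fun_upd: "a \<notin> S \<Longrightarrow> count_in Q (A(a := v)) S = count_in Q A S"
  by (auto simp: count_in_def intro: arg_cong[where f = card])

lemma count_in_mono:
  "finite S \<Longrightarrow> (\<And>x. x \<in> S \<Longrightarrow> Q (A x) \<Longrightarrow> Q' (A x)) \<Longrightarrow> count_in Q A S \<le> count_in Q' A S"
  by (auto simp: count_in_def intro!: card_mono)

lemma count_in_le_card: "finite S \<Longrightarrow> count_in Q A S \<le> card S"
  by (auto simp: count_in_def intro!: card_mono)

lemma count_in_perturb:
  assumes "finite S" "finite D" "\<And>a. a \<notin> D \<Longrightarrow> A' a = A a"
  shows "count_in Q A' S \<le> count_in Q A S + card D"
proof -
  have "card {x \<in> S. Q (A' x)} \<le> card ({x \<in> S. Q (A x)} \<union> D)"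
    using assms by (intro card_mono) auto
  also have "\<dots> \<le> card {x \<in> S. Q (A x)} + card D"
    by (rule card_Un_le)
  finally show ?thesis by (simp add: count_in_def)
qed

lemma atLeastLessThan_insert: "i < m \<Longrightarrow> {i..<m} = insert i {Suc i..<m}"
  by auto

lemma rank_input_array: "rank (input_array n M) e = count_in (\<lambda>v. v \<le> e) M {..<n}"
  by (auto simp: rank_def count_in_def input_array_def intro: arg_cong[where f = card])

lemma strict_rank_le_rank: "strict_rank X e \<le> rank X e"
  unfolding strict_rank_def rank_def by (intro card_mono) auto

lemma strict_rank_eq_rank:
  fixes e :: nat
  assumes "0 < e"
  shows "strict_rank X e = rank X (e - 1)"
proof -
  have "X ! i < e \<longleftrightarrow> X ! i \<le> e - 1" for i using assms by auto
  then show ?thesis by (simp add: strict_rank_def rank_def)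
qed

text \<open>The clause of \<open>selects\<close> for repeated entries, written with sums so that
  natural subtraction never truncates.\<close>

definition near_rank :: "nat \<Rightarrow> 'a::linorder list \<Rightarrow> nat \<Rightarrow> 'a \<Rightarrow> bool" where
  "near_rank \<alpha> X k e \<longleftrightarrow> k \<le> rank X e + \<alpha> \<and> strict_rank X e + 1 \<le> k + \<alpha>"

text \<open>At most one entry of a distinct array equals \<open>e\<close>, so its rank exceeds its
  strict rank by at most one. This holds whether or not \<open>e\<close> is an entry.\<close>

lemma selects_if_near_rank:
  assumes "near_rank \<alpha> X k e"
  shows "selects \<alpha> X k e"
proof -
  have "rank X e \<le> strict_rank X e + 1" if "distinct X"
  proof -
    have "card {i. i < length X \<and> X ! i = e} \<le> 1"
      using that by (auto simp: card_le_Suc0_iff_eq nth_eq_iff_index_eq)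
    moreover have "{i. i < length X \<and> X ! i \<le> e} =
        {i. i < length X \<and> X ! i < e} \<union> {i. i < length X \<and> X ! i = e}"
      by auto
    then have "rank X e \<le> strict_rank X e + card {i. i < length X \<and> X ! i = e}"
      by (simp add: rank_def strict_rank_def card_Un_le)
    ultimately show ?thesis by simp
  qed
  then show ?thesis
    using assms by (auto simp: near_rank_def selects_def alpha_rank_def)
qed

section \<open>Random pivots\<close>

abbreviation bits :: "nat \<Rightarrow> nat" where
  "bits \<equiv> floorlog 2"

lemma bits_0 [simp]: "bits 0 = 0"
  by (simp add: floorlog_def)

lemma bits_half: "0 < q \<Longrightarrow> bits q = Suc (bits (q div 2))"
  by (subst compute_floorlog) simp

lemma bits_le: "bits q \<le> q"
proof -
  have "q < 2 ^ q" by (rule less_exp)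
  then show ?thesis by (simp add: floorlog_le_iff)
qed

text \<open>The mean of \<open>f\<close> over all numbers obtained from \<open>R\<close> by appending \<open>bits q\<close> binary digits.\<close>

fun coin_mean :: "(nat \<Rightarrow> real) \<Rightarrow> nat \<Rightarrow> nat \<Rightarrow> real" where
  "coin_mean f q R = (if q = 0 then f R
     else (coin_mean f (q div 2) (2 * R) + coin_mean f (q div 2) (2 * R + 1)) / 2)"

declare coin_mean.simps [simp del]

lemma coin_mean_0 [simp]: "coin_mean f 0 R = f R"
  by (simp add: coin_mean.simps)

text \<open>The next digit is the most significant of the missing ones: it chooses between the lower
  and the upper half of the \<open>2 ^ bits q\<close> completions.\<close>

lemma coin_mean_eq_sum:
  "coin_mean f q R = (\<Sum>x<2 ^ bits q. f (R * 2 ^ bits q + x)) / 2 ^ bits q"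
proof (induction f q R rule: coin_mean.induct)
  case (1 f q R)
  show ?case
  proof (cases "q = 0")
    case False
    define N where "N = (2 :: nat) ^ bits (q div 2)"
    have N: "2 ^ bits q = N + N"
      using False by (simp add: bits_half N_def)
    have "{..<N + N} = {..<N} \<union> (+) N ` {..<N}"
      by (auto simp: image_iff) (metis add_diff_inverse_nat add_less_cancel_left lessThan_iff)
    then have "(\<Sum>x<N + N. f (R * (N + N) + x)) =
        (\<Sum>x\<in>{..<N} \<union> (+) N ` {..<N}. f (R * (N + N) + x))"
      by (rule sum.cong) simp
    also have "\<dots> = (\<Sum>x<N. f (R * (N + N) + x)) + (\<Sum>x\<in>(+) N ` {..<N}. f (R * (N + N) + x))"
      by (rule sum.union_disjoint) auto
    also have "(\<Sum>x\<in>(+) N ` {..<N}. f (R * (N + N) + x)) = (\<Sum>x<N. f (R * (N + N) + (N + x)))"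
      by (subst sum.reindex) auto
    finally have "(\<Sum>x<N + N. f (R * (N + N) + x)) =
        (\<Sum>x<N. f (2 * R * N + x)) + (\<Sum>x<N. f ((2 * R + 1) * N + x))"
      by (simp add: algebra_simps mult_2_right)
    moreover have pow: "(2 :: real) ^ bits (q div 2) = real N"
      by (simp add: N_def)
    moreover from this have "(2 :: real) ^ bits q = real N * 2"
      using False by (simp add: bits_half)
    ultimately show ?thesis
      using 1 False by (simp add: coin_mean.simps[of f q R] N pow N_def[symmetric] add_divide_distrib)
  qed (simp add: coin_mean.simps)
qed

text \<open>Entries equal to the pivot are on neither side: they are discarded whichever end of the
  interval the pivot replaces, so repeated entries do not slow the selection.\<close>

definition larger_side :: "(nat \<Rightarrow> nat) \<Rightarrow> nat \<Rightarrow> nat \<Rightarrow> real" where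
  "larger_side A m p = max (real (count_in (\<lambda>v. v < p) A {..<m})) (real (count_in (\<lambda>v. p < v) A {..<m}))"

text \<open>Take a bad index with the least entry. More than three quarters of all entries lie
  strictly below it, hence outside \<open>D\<close>.\<close>

lemma card_low_pivots:
  fixes A :: "nat \<Rightarrow> nat" and m :: nat
  defines "D \<equiv> {i. i < m \<and> 3 * m < 4 * count_in (\<lambda>v. v < A i) A {..<m}}"
  shows "4 * card D \<le> m"
proof (cases "D = {}")
  case False
  then have "Min (A ` D) \<in> A ` D" "\<And>j. j \<in> D \<Longrightarrow> Min (A ` D) \<le> A j"
    by (simp_all add: D_def)
  then obtain i where i: "i \<in> D" "\<And>j. j \<in> D \<Longrightarrow> A i \<le> A j"
    by fastforce
  have "card (D \<union> {x \<in> {..<m}. A x < A i}) \<le> card {..<m}"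
    by (intro card_mono) (auto simp: D_def)
  moreover have "card (D \<union> {x \<in> {..<m}. A x < A i}) = card D + card {x \<in> {..<m}. A x < A i}"
    using i by (intro card_Un_disjoint) (force simp: D_def)+
  moreover have "3 * m < 4 * card {x \<in> {..<m}. A x < A i}"
    using i by (simp add: D_def count_in_def)
  ultimately show ?thesis by simp
qed simp

lemma card_high_pivots:
  fixes A :: "nat \<Rightarrow> nat" and m :: nat
  defines "D \<equiv> {i. i < m \<and> 3 * m < 4 * count_in (\<lambda>v. A i < v) A {..<m}}"
  shows "4 * card D \<le> m"
proof (cases "D = {}")
  case False
  then have "Max (A ` D) \<in> A ` D" "\<And>j. j \<in> D \<Longrightarrow> A j \<le> Max (A ` D)"
    by (simp_all add: D_def)
  then obtain i where i: "i \<in> D" "\<And>j. j \<in> D \<Longrightarrow> A j \<le> A i"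
    by fastforce
  have "card (D \<union> {x \<in> {..<m}. A i < A x}) \<le> card {..<m}"
    by (intro card_mono) (auto simp: D_def)
  moreover have "card (D \<union> {x \<in> {..<m}. A i < A x}) = card D + card {x \<in> {..<m}. A i < A x}"
    using i by (intro card_Un_disjoint) (force simp: D_def)+
  moreover have "3 * m < 4 * card {x \<in> {..<m}. A i < A x}"
    using i by (simp add: D_def count_in_def)
  ultimately show ?thesis by simp
qed simp

text \<open>
  At least half of the indices yield a pivot with at most \<open>3 m / 4\<close> entries on either side, and each
  index is chosen with probability at least \<open>1 / (2 m)\<close>.
\<close>

lemma mean_larger_side:
  assumes m: "0 < m"
  shows "coin_mean (\<lambda>R. larger_side A m (A (R mod m))) m 0 \<le> 15 / 16 * m"
proof -
  define N where "N = (2 :: nat) ^ bits m"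
  define f where "f i = larger_side A m (A i)" for i
  define G where "G = {i. i < m \<and> f i \<le> 3 / 4 * m}"
  have f_le: "f i \<le> m" for i
    using count_in_le_card[of "{..<m}" "\<lambda>v. v < A i" A] count_in_le_card[of "{..<m}" "\<lambda>v. A i < v" A]
    by (simp add: f_def larger_side_def)
  have "m < N" using m floorlog_bounds[of m 2] by (simp add: N_def)
  have "N = 2 * 2 ^ (bits m - 1)" using m by (simp add: N_def bits_half)
  then have N_le: "N \<le> 2 * m" using m floorlog_bounds[of m 2] by simp
  have "{..<m} \<subseteq> G \<union> {i. i < m \<and> 3 * m < 4 * count_in (\<lambda>v. v < A i) A {..<m}}
      \<union> {i. i < m \<and> 3 * m < 4 * count_in (\<lambda>v. A i < v) A {..<m}}" (is "_ \<subseteq> _ \<union> ?L \<union> ?H")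
    by (auto simp: G_def f_def larger_side_def)
  then have "card {..<m} \<le> card (G \<union> ?L \<union> ?H)"
    by (intro card_mono) (auto simp: G_def)
  also have "\<dots> \<le> card G + card ?L + card ?H"
    by (meson add_mono card_Un_le order.trans order_refl)
  finally have G: "m \<le> 2 * card G"
    using card_low_pivots[of m A] card_high_pivots[of m A] by simp
  \<comment> \<open>An \<open>x\<close> in \<open>G\<close> is below \<open>m\<close> and thus its
    own residue; every other \<open>x\<close> gets the trivial bound \<open>m\<close>.\<close>
  have "(\<Sum>x<N. f (x mod m)) \<le> (\<Sum>x<N. real m - of_bool (x \<in> G) * (m / 4))"
    using f_le by (intro sum_mono) (auto simp: G_def)
  also have "\<dots> = N * real m - (\<Sum>x<N. of_bool (x \<in> G)) * (m / 4)"
    by (simp add: sum_subtractf sum_distrib_right)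
  also have "(\<Sum>x<N. of_bool (x \<in> G) :: real) = card G"
  proof -
    have "{..<N} \<inter> G = G" using \<open>m < N\<close> by (auto simp: G_def)
    then show ?thesis by (simp add: of_bool_def flip: sum.inter_restrict)
  qed
  also have "N * real m - card G * (m / 4) \<le> N * real m - m / 2 * (m / 4)"
    using G by (intro diff_left_mono mult_right_mono) auto
  \<comment> \<open>A quarter of \<open>m\<close> is saved with probability at least 1/4, because
    \<open>N \<le> 2 * m\<close>; hence the factor 1 - 1/16.\<close>
  also have "\<dots> \<le> N * (15 / 16 * m)"
  proof -
    have "real N * real m \<le> (2 * real m) * real m" using N_le by (intro mult_right_mono) simp_all
    then show ?thesis by (simp add: field_simps)
  qed
  finally have "(\<Sum>x<N. f (x mod m)) / N \<le> 15 / 16 * m"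
    using m \<open>m < N\<close> by (simp add: divide_le_eq mult.commute)
  then show ?thesis by (simp add: coin_mean_eq_sum f_def N_def)
qed

lemma larger_side_perturb:
  assumes "finite D" "\<And>a. a \<notin> D \<Longrightarrow> A' a = A a"
  shows "larger_side A' m p \<le> larger_side A m p + card D"
  using count_in_perturb[of "{..<m}" D A' A "\<lambda>v. v < p"] count_in_perturb[of "{..<m}" D A' A "\<lambda>v. p < v"] assms
  by (auto simp: larger_side_def)

section \<open>The program\<close>

text \<open>
  Register 0 holds the length \<open>m\<close> of the current segment, which is the prefix \<open>{..<m}\<close> of the
  memory, and finally the result; 1 holds \<open>k\<close>; the result is known to lie between the contents of
  2 (\<open>lo\<close>) and 3 (\<open>hi\<close>); 4, 12 and 13 hold the constants 1, 2 and 0; 5 counts the discarded entries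
  that were at most \<open>lo\<close>; 6 and 7 are indices; 8 holds the pivot, 9 the entry under inspection,
  10 and 11 count the entries less than, respectively at most, the pivot.

  The addresses of the blocks are 4 (computation of \<open>2 ^ w - 1\<close>), 7 (choice of the pivot),
  20 (counting), 31 (narrowing the interval from \<open>lo\<close> to \<open>hi\<close>), 38 (discarding all entries not
  strictly between \<open>lo\<close> and \<open>hi\<close>) and 50 (test whether \<open>lo\<close> or \<open>hi\<close> is the result).
\<close>

definition prog :: "instr list" where
  "prog = [
     Const 2 0, Const 4 1, Const 6 1, Const 12 2,
     Op Plus 3 3 6, Op Plus 6 6 6, JumpLess 13 6 4,
     Op Plus 6 0 13, Const 7 0,
     Toss 8, Op Plus 7 7 7, Op Plus 7 7 8, Op Div 6 6 12, JumpLess 13 6 9,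
     Op Mod 7 7 0, Load 8 7, JumpLess 2 8 18, Jump 38, JumpLess 8 3 20, Jump 38,
     Op Plus 10 5 13, Op Plus 11 5 13, Const 6 0,
     Load 9 6, JumpLess 9 8 27, JumpLess 8 9 29, Jump 28,
     Op Plus 10 10 4, Op Plus 11 11 4, Op Plus 6 6 4, JumpLess 6 0 23,
     JumpLess 10 1 34, Op Plus 3 8 13, Jump 38,
     JumpLess 11 1 37, Op Plus 0 8 13, Halt, Op Plus 2 8 13,
     Const 6 0, Const 7 0,
     Load 9 6, JumpLess 2 9 44, Op Plus 5 5 4, Jump 48, JumpLess 9 3 46, Jump 48,
     Store 7 9, Op Plus 7 7 4, Op Plus 6 6 4, JumpLess 6 0 40,
     Op Plus 0 7 13, JumpLess 5 1 54, Op Plus 0 2 13, Halt,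
     Op Plus 9 5 7, JumpLess 9 1 57, Jump 7, Op Plus 0 3 13, Halt]"

lemma length_prog [simp]: "length prog = 59"
  by (simp add: prog_def)

lemma prog_nth [simp]:
  "prog ! 0 = Const 2 0" "prog ! (Suc 0) = Const 4 1" "prog ! 2 = Const 6 1" "prog ! 3 = Const 12 2"
  "prog ! 4 = Op Plus 3 3 6" "prog ! 5 = Op Plus 6 6 6" "prog ! 6 = JumpLess 13 6 4"
  "prog ! 7 = Op Plus 6 0 13" "prog ! 8 = Const 7 0"
  "prog ! 9 = Toss 8" "prog ! 10 = Op Plus 7 7 7" "prog ! 11 = Op Plus 7 7 8"
  "prog ! 12 = Op Div 6 6 12" "prog ! 13 = JumpLess 13 6 9"
  "prog ! 14 = Op Mod 7 7 0" "prog ! 15 = Load 8 7" "prog ! 16 = JumpLess 2 8 18"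
  "prog ! 17 = Jump 38" "prog ! 18 = JumpLess 8 3 20" "prog ! 19 = Jump 38"
  "prog ! 20 = Op Plus 10 5 13" "prog ! 21 = Op Plus 11 5 13" "prog ! 22 = Const 6 0"
  "prog ! 23 = Load 9 6" "prog ! 24 = JumpLess 9 8 27" "prog ! 25 = JumpLess 8 9 29"
  "prog ! 26 = Jump 28" "prog ! 27 = Op Plus 10 10 4" "prog ! 28 = Op Plus 11 11 4"
  "prog ! 29 = Op Plus 6 6 4" "prog ! 30 = JumpLess 6 0 23"
  "prog ! 31 = JumpLess 10 1 34" "prog ! 32 = Op Plus 3 8 13" "prog ! 33 = Jump 38"
  "prog ! 34 = JumpLess 11 1 37" "prog ! 35 = Op Plus 0 8 13" "prog ! 36 = Halt"
  "prog ! 37 = Op Plus 2 8 13" "prog ! 38 = Const 6 0" "prog ! 39 = Const 7 0"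
  "prog ! 40 = Load 9 6" "prog ! 41 = JumpLess 2 9 44" "prog ! 42 = Op Plus 5 5 4"
  "prog ! 43 = Jump 48" "prog ! 44 = JumpLess 9 3 46" "prog ! 45 = Jump 48"
  "prog ! 46 = Store 7 9" "prog ! 47 = Op Plus 7 7 4" "prog ! 48 = Op Plus 6 6 4"
  "prog ! 49 = JumpLess 6 0 40" "prog ! 50 = Op Plus 0 7 13" "prog ! 51 = JumpLess 5 1 54"
  "prog ! 52 = Op Plus 0 2 13" "prog ! 53 = Halt" "prog ! 54 = Op Plus 9 5 7"
  "prog ! 55 = JumpLess 9 1 57" "prog ! 56 = Jump 7" "prog ! 57 = Op Plus 0 3 13"
  "prog ! 58 = Halt"
  by (simp_all add: prog_def)

lemma lessThan_59:
  "{..<59 :: nat} = {58, 57, 56, 55, 54, 53, 52, 51, 50, 49, 48, 47, 46, 45, 44, 43, 42, 41, 40, 39, 38, 37,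
    36, 35, 34, 33, 32, 31, 30, 29, 28, 27, 26, 25, 24, 23, 22, 21, 20, 19, 18, 17, 16, 15,
    14, 13, 12, 11, 10, 9, 8, 7, 6, 5, 4, 3, 2, Suc 0, 0}"
  by (simp add: lessThan_nat_numeral lessThan_Suc)

section \<open>Correctness\<close>

definition close :: "nat \<Rightarrow> nat \<Rightarrow> nat \<Rightarrow> bool" where
  "close \<alpha> a b \<longleftrightarrow> a \<le> b + \<alpha> \<and> b \<le> a + \<alpha>"

locale instance_of_selection =
  fixes w n k :: nat and M :: "nat \<Rightarrow> nat"
  assumes k: "1 \<le> k" "k \<le> n" and n: "n < 2 ^ w" and M: "\<And>a. M a < 2 ^ w"
begin

abbreviation X :: "nat list" where
  "X \<equiv> input_array n M"

text \<open>
  For every threshold \<open>e\<close> in the current interval, \<open>B\<close> discarded entries and the entries stored in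
  the addresses \<open>S\<close> account for the rank of \<open>e\<close> in the input, up to the number \<open>\<alpha>\<close> of corruptions so far.
\<close>

definition segment :: "nat \<Rightarrow> nat \<Rightarrow> nat \<Rightarrow> (nat \<Rightarrow> nat) \<Rightarrow> nat \<Rightarrow> nat set \<Rightarrow> bool" where
  "segment \<alpha> lo hi A B S \<longleftrightarrow>
     (\<forall>e. lo \<le> e \<longrightarrow> e < hi \<longrightarrow> close \<alpha> (rank X e) (B + count_in (\<lambda>v. v \<le> e) A S))"

text \<open>Between \<open>Load\<close> and \<open>Store\<close> the entry sits in a register. Its
  cell is no longer in \<open>S\<close>, so corrupting that cell meanwhile does no harm.\<close>

definition segment_with :: "nat \<Rightarrow> nat \<Rightarrow> nat \<Rightarrow> nat \<Rightarrow> (nat \<Rightarrow> nat) \<Rightarrow> nat \<Rightarrow> nat set \<Rightarrow> bool" where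
  "segment_with v \<alpha> lo hi A B S \<longleftrightarrow>
     (\<forall>e. lo \<le> e \<longrightarrow> e < hi \<longrightarrow> close \<alpha> (rank X e) (B + of_bool (v \<le> e) + count_in (\<lambda>v. v \<le> e) A S))"

text \<open>\<open>S\<close> holds the addresses still to be scanned. Once it is empty,
  \<open>L\<close> and \<open>E\<close> themselves estimate the strict rank and the rank of the
  pivot.\<close>

definition counts :: "nat \<Rightarrow> nat \<Rightarrow> (nat \<Rightarrow> nat) \<Rightarrow> nat \<Rightarrow> nat \<Rightarrow> nat set \<Rightarrow> bool" where
  "counts \<alpha> p A L E S \<longleftrightarrow> close \<alpha> (strict_rank X p) (L + count_in (\<lambda>v. v < p) A S) \<and>
     close \<alpha> (rank X p) (E + count_in (\<lambda>v. v \<le> p) A S)"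

text \<open>Each end satisfies one half of \<open>near_rank\<close> in advance; the other half has
  to come from the counts when that end is returned.\<close>

definition limits :: "nat \<Rightarrow> nat \<Rightarrow> nat \<Rightarrow> bool" where
  "limits \<alpha> lo hi \<longleftrightarrow> lo < hi \<and> k \<le> rank X hi + \<alpha> \<and> strict_rank X lo + 1 \<le> k + \<alpha>"

text \<open>One assertion per program address. Bounds such as
  \<open>r 5 + r 7 + r 0 \<le> n + r 6\<close> (discarded, kept and unread entries together are at
  most \<open>n\<close>) keep additions from wrapping, as \<open>n < 2 ^ w\<close>. Likewise
  \<open>(r 7 + 1) * 2 ^ bits (r 6) \<le> 2 ^ w\<close> says that the partial random index fits into
  a word however its missing digits turn out.\<close>

definition inv :: "nat \<Rightarrow> nat \<Rightarrow> (nat \<Rightarrow> nat) \<Rightarrow> (nat \<Rightarrow> nat) \<Rightarrow> bool" where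
  "inv \<alpha> p r A \<longleftrightarrow> p < 59 \<and> r 13 = 0 \<and> r 1 = k \<and>
    (p \<le> 6 \<longrightarrow> r 0 = n \<and> r 5 = 0 \<and> (\<forall>e. close \<alpha> (rank X e) (count_in (\<lambda>v. v \<le> e) A {..<n}))) \<and>
    (1 \<le> p \<and> p \<le> 6 \<longrightarrow> r 2 = 0) \<and> (2 \<le> p \<longrightarrow> r 4 = 1) \<and> (4 \<le> p \<longrightarrow> r 12 = 2 mod 2 ^ w) \<and>
    (p \<le> 3 \<longrightarrow> r 3 = 0) \<and> (p = 3 \<longrightarrow> r 6 = 1) \<and>
    (p = 4 \<longrightarrow> (\<exists>j<w. r 6 = 2 ^ j \<and> Suc (r 3) = 2 ^ j)) \<and>
    (p = 5 \<longrightarrow> (\<exists>j<w. r 6 = 2 ^ j \<and> Suc (r 3) = 2 * 2 ^ j)) \<and>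
    (p = 6 \<longrightarrow> (\<exists>j\<le>w. 1 \<le> j \<and> r 6 = 2 ^ j mod 2 ^ w \<and> Suc (r 3) = 2 ^ j)) \<and>
    (7 \<le> p \<longrightarrow> limits \<alpha> (r 2) (r 3)) \<and>
    (7 \<le> p \<and> p \<le> 39 \<and> p \<noteq> 36 \<longrightarrow> 1 \<le> r 0 \<and> r 5 + r 0 \<le> n \<and> segment \<alpha> (r 2) (r 3) A (r 5) {..<r 0}) \<and>
    (p = 8 \<longrightarrow> r 6 = r 0) \<and>
    (p = 9 \<longrightarrow> 0 < r 6 \<and> (r 7 + 1) * 2 ^ bits (r 6) \<le> 2 ^ w) \<and>
    (p = 10 \<longrightarrow> r 8 \<le> 1 \<and> 0 < r 6 \<and> (2 * r 7 + 2) * 2 ^ bits (r 6 div 2) \<le> 2 ^ w) \<and>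
    (p = 11 \<longrightarrow> r 8 \<le> 1 \<and> 0 < r 6 \<and> (r 7 + 2) * 2 ^ bits (r 6 div 2) \<le> 2 ^ w) \<and>
    (p = 12 \<longrightarrow> 0 < r 6 \<and> (r 7 + 1) * 2 ^ bits (r 6 div 2) \<le> 2 ^ w) \<and>
    (p = 13 \<longrightarrow> (r 7 + 1) * 2 ^ bits (r 6) \<le> 2 ^ w) \<and>
    (p = 15 \<longrightarrow> r 7 < r 0) \<and>
    (18 \<le> p \<and> p \<le> 19 \<longrightarrow> r 2 < r 8) \<and>
    (20 \<le> p \<and> p \<le> 32 \<or> p = 34 \<or> p = 35 \<or> p = 37 \<longrightarrow> r 2 < r 8 \<and> r 8 < r 3) \<and>
    (p = 21 \<longrightarrow> r 10 = r 5) \<and>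
    (p = 22 \<longrightarrow> r 10 = r 5 \<and> r 11 = r 5) \<and>
    (p = 23 \<or> p = 30 \<longrightarrow> r 10 \<le> r 5 + r 6 \<and> r 11 \<le> r 5 + r 6 \<and> r 6 \<le> r 0 \<and> counts \<alpha> (r 8) A (r 10) (r 11) {r 6..<r 0}) \<and>
    (23 \<le> p \<and> p \<le> 29 \<longrightarrow> r 6 < r 0) \<and>
    (24 \<le> p \<and> p \<le> 27 \<longrightarrow> r 10 \<le> r 5 + r 6 \<and> r 11 \<le> r 5 + r 6 \<and>
       counts \<alpha> (r 8) A (r 10 + of_bool (r 9 < r 8)) (r 11 + of_bool (r 9 \<le> r 8)) {Suc (r 6)..<r 0}) \<and>
    (p = 25 \<longrightarrow> \<not> r 9 < r 8) \<and> (p = 26 \<longrightarrow> r 9 = r 8) \<and> (p = 27 \<longrightarrow> r 9 < r 8) \<and>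
    (p = 28 \<longrightarrow> r 10 \<le> r 5 + Suc (r 6) \<and> r 11 \<le> r 5 + r 6 \<and>
       counts \<alpha> (r 8) A (r 10) (Suc (r 11)) {Suc (r 6)..<r 0}) \<and>
    (p = 29 \<longrightarrow> r 10 \<le> r 5 + Suc (r 6) \<and> r 11 \<le> r 5 + Suc (r 6) \<and>
       counts \<alpha> (r 8) A (r 10) (r 11) {Suc (r 6)..<r 0}) \<and>
    (p = 31 \<or> p = 34 \<longrightarrow> counts \<alpha> (r 8) A (r 10) (r 11) {}) \<and>
    (p = 32 \<longrightarrow> k \<le> rank X (r 8) + \<alpha>) \<and>
    (p = 34 \<longrightarrow> r 10 < k) \<and>
    (p = 35 \<longrightarrow> near_rank \<alpha> X k (r 8)) \<and>
    (p = 36 \<or> p = 53 \<or> p = 58 \<longrightarrow> near_rank \<alpha> X k (r 0)) \<and>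
    (p = 37 \<longrightarrow> strict_rank X (r 8) + 1 \<le> k + \<alpha>) \<and>
    (p = 39 \<longrightarrow> r 6 = 0) \<and>
    (40 \<le> p \<and> p \<le> 48 \<longrightarrow> r 6 < r 0) \<and>
    (40 \<le> p \<and> p \<le> 49 \<longrightarrow> r 0 \<le> n) \<and>
    (40 \<le> p \<and> p \<le> 49 \<and> p \<noteq> 48 \<longrightarrow> r 7 \<le> r 6) \<and>
    (p = 40 \<or> p = 49 \<longrightarrow> r 6 \<le> r 0 \<and> r 5 + r 7 + r 0 \<le> n + r 6 \<and>
       segment \<alpha> (r 2) (r 3) A (r 5) ({..<r 7} \<union> {r 6..<r 0})) \<and>
    (p = 41 \<or> p = 42 \<or> p = 44 \<or> p = 46 \<longrightarrow> r 5 + r 7 + r 0 \<le> n + r 6 \<and>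
       segment_with (r 9) \<alpha> (r 2) (r 3) A (r 5) ({..<r 7} \<union> {Suc (r 6)..<r 0})) \<and>
    (p = 42 \<longrightarrow> r 9 \<le> r 2) \<and> (p = 44 \<or> p = 46 \<longrightarrow> r 2 < r 9) \<and> (p = 46 \<longrightarrow> r 9 < r 3) \<and>
    (p = 43 \<or> p = 45 \<or> p = 48 \<longrightarrow> r 7 \<le> Suc (r 6) \<and> r 5 + r 7 + r 0 \<le> n + Suc (r 6) \<and>
       segment \<alpha> (r 2) (r 3) A (r 5) ({..<r 7} \<union> {Suc (r 6)..<r 0})) \<and>
    (p = 47 \<longrightarrow> r 5 + r 7 + r 0 \<le> n + r 6 \<and>
       segment \<alpha> (r 2) (r 3) A (r 5) ({..<Suc (r 7)} \<union> {Suc (r 6)..<r 0})) \<and>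
    (p = 50 \<longrightarrow> r 5 + r 7 \<le> n \<and> segment \<alpha> (r 2) (r 3) A (r 5) {..<r 7}) \<and>
    (p = 51 \<or> 54 \<le> p \<and> p \<le> 56 \<longrightarrow> r 7 = r 0 \<and> r 5 + r 0 \<le> n \<and> segment \<alpha> (r 2) (r 3) A (r 5) {..<r 0}) \<and>
    (p = 52 \<longrightarrow> near_rank \<alpha> X k (r 2)) \<and>
    (p = 54 \<or> p = 55 \<longrightarrow> r 5 < k) \<and>
    (p = 55 \<longrightarrow> r 9 = r 5 + r 0) \<and>
    (p = 56 \<longrightarrow> 1 \<le> r 0) \<and>
    (p = 57 \<longrightarrow> near_rank \<alpha> X k (r 3))"

section \<open>Effect of single scan steps on the counts\<close>

lemma segment_load:
  assumes "i < m" "j \<le> i" "segment \<alpha> lo hi A B ({..<j} \<union> {i..<m})"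
  shows "segment_with (A i) \<alpha> lo hi A B ({..<j} \<union> {Suc i..<m})"
proof -
  have "{..<j} \<union> {i..<m} = insert i ({..<j} \<union> {Suc i..<m})"
    using assms(1) by auto
  then show ?thesis
    using assms by (simp add: segment_def segment_with_def add.assoc)
qed

text \<open>The half-open range of thresholds is made for this: an entry up to \<open>lo\<close>
  counts for all of them and moves into \<open>B\<close>, while an entry from \<open>hi\<close> on
  counts for none and can be forgotten.\<close>

lemma segment_with_below: "v \<le> lo \<Longrightarrow> segment_with v \<alpha> lo hi A B S \<Longrightarrow> segment \<alpha> lo hi A (Suc B) S"
  by (auto simp: segment_def segment_with_def)

lemma segment_with_above: "hi \<le> v \<Longrightarrow> segment_with v \<alpha> lo hi A B S \<Longrightarrow> segment \<alpha> lo hi A B S"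
  by (auto simp: segment_def segment_with_def not_le)

lemma segment_with_store:
  assumes "j \<le> i" "segment_with v \<alpha> lo hi A B ({..<j} \<union> {Suc i..<m})"
  shows "segment \<alpha> lo hi (A(j := v)) B ({..<Suc j} \<union> {Suc i..<m})"
proof -
  have "{..<Suc j} \<union> {Suc i..<m} = insert j ({..<j} \<union> {Suc i..<m})" by auto
  then show ?thesis
    using assms by (simp add: segment_def segment_with_def add.assoc count_in_fun_upd)
qed

lemma segment_subset:
  "lo \<le> lo' \<Longrightarrow> hi' \<le> hi \<Longrightarrow> segment \<alpha> lo hi A B S \<Longrightarrow> segment \<alpha> lo' hi' A B S"
  by (auto simp: segment_def)

lemma counts_load:
  assumes "i < m" "counts \<alpha> p A L E {i..<m}"
  shows "counts \<alpha> p A (L + of_bool (A i < p)) (E + of_bool (A i \<le> p)) {Suc i..<m}"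
  using assms by (simp add: counts_def atLeastLessThan_insert add.assoc)

text \<open>The strict rank of the pivot is the rank of \<open>p - 1\<close>. Both
  \<open>p - 1\<close> and \<open>p\<close> are admissible thresholds because the pivot lies
  strictly inside the interval.\<close>

lemma counts_init:
  assumes "lo < p" "p < hi" "segment \<alpha> lo hi A B {..<m}"
  shows "counts \<alpha> p A B B {0..<m}"
proof -
  have eq: "(\<lambda>v. v \<le> p - Suc 0) = (\<lambda>v. v < p)" using assms(1) by (intro ext) auto
  have "close \<alpha> (rank X (p - 1)) (B + count_in (\<lambda>v. v \<le> p - 1) A {..<m})"
    "close \<alpha> (rank X p) (B + count_in (\<lambda>v. v \<le> p) A {..<m})"
    using assms unfolding segment_def by simp_all
  then show ?thesis
    using assms(1) by (simp add: counts_def eq strict_rank_eq_rank atLeast0LessThan)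
qed

text \<open>\<open>lo\<close> is itself a threshold, so \<open>B\<close> alone bounds its rank from
  below, up to \<open>\<alpha>\<close>.\<close>

lemma near_rank_lo:
  assumes "limits \<alpha> lo hi" "segment \<alpha> lo hi A B S" "k \<le> B"
  shows "near_rank \<alpha> X k lo"
proof -
  have "close \<alpha> (rank X lo) (B + count_in (\<lambda>v. v \<le> lo) A S)"
    using assms by (simp add: segment_def limits_def)
  with assms show ?thesis by (simp add: near_rank_def limits_def close_def)
qed

text \<open>Even all remaining entries do not reach rank \<open>k\<close>; the last threshold
  \<open>hi - 1\<close> yields the strict rank of \<open>hi\<close>.\<close>

lemma near_rank_hi:
  assumes "limits \<alpha> lo hi" "segment \<alpha> lo hi A B {..<m}" "B + m < k"
  shows "near_rank \<alpha> X k hi"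
proof -
  have "close \<alpha> (rank X (hi - 1)) (B + count_in (\<lambda>v. v \<le> hi - 1) A {..<m})"
    using assms by (auto simp: segment_def limits_def)
  moreover have "count_in (\<lambda>v. v \<le> hi - 1) A {..<m} \<le> m"
    using count_in_le_card[of "{..<m}"] by simp
  moreover have "strict_rank X hi = rank X (hi - 1)"
    using assms by (intro strict_rank_eq_rank) (auto simp: limits_def)
  ultimately show ?thesis
    using assms by (simp add: near_rank_def limits_def close_def)
qed


definition words :: "(nat \<Rightarrow> nat) \<Rightarrow> (nat \<Rightarrow> nat) \<Rightarrow> bool" where
  "words r A \<longleftrightarrow> (\<forall>x. r x < 2 ^ w) \<and> (\<forall>a. A a < 2 ^ w)"

lemma words_exec:
  "words (regs s) (mem s) \<Longrightarrow> words (regs (exec w b i s)) (mem (exec w b i s))"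
  by (cases i) (auto simp: words_def set_reg_def)

lemma w_pos: "0 < w"
  using k n by (cases w) auto

text \<open>For \<open>w = 1\<close> the constant 2 wraps to 0. Then \<open>q\<close> is 0 or 1, and
  division by zero gives 0, which is still \<open>q div 2\<close>.\<close>

lemma word_half: "q < 2 ^ w \<Longrightarrow> q div (2 mod 2 ^ w) mod 2 ^ w = q div (2 :: nat)"
proof (cases "w = 1")
  case False
  assume "q < 2 ^ w"
  moreover have "(2 :: nat) ^ 1 < 2 ^ w" using w_pos False by (intro power_strict_increasing) auto
  ultimately show ?thesis by simp
qed simp

lemma word_mod_eq:
  fixes a :: nat
  assumes "(a + c) * 2 ^ N \<le> 2 ^ w" "0 < c"
  shows "a mod 2 ^ w = a"
proof -
  have "a + c \<le> (a + c) * 2 ^ N" by simp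
  with assms show ?thesis by (intro mod_less) linarith
qed

lemma counts_empty [simp]:
  "counts \<alpha> p A L E {} \<longleftrightarrow> close \<alpha> (strict_rank X p) L \<and> close \<alpha> (rank X p) E"
  by (simp add: counts_def)

text \<open>No word exceeds \<open>m\<close>, so its rank is \<open>n\<close>, and no word is below
  0.\<close>

lemma limits_init:
  assumes m: "Suc m = 2 ^ w"
  shows "limits \<alpha> 0 m"
proof -
  have "M v \<le> m" for v using M[of v] m by linarith
  then have "count_in (\<lambda>v. v \<le> m) M {..<n} = card {..<n}"
    by (simp add: count_in_def)
  moreover have "(2 :: nat) ^ 1 \<le> 2 ^ w" using w_pos by (intro power_increasing) auto
  then have "0 < m" using m by simp
  ultimately show ?thesis using k by (simp add: limits_def rank_input_array strict_rank_def)
qed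

definition inv_next :: "nat \<Rightarrow> nat \<Rightarrow> (nat \<Rightarrow> nat) \<Rightarrow> (nat \<Rightarrow> nat) \<Rightarrow> bool \<Rightarrow> bool" where
  "inv_next \<alpha> p r A b \<longleftrightarrow>
     (let s = exec w b (prog ! p) \<lparr>pc = p, regs = r, mem = A\<rparr> in inv \<alpha> (pc s) (regs s) (mem s))"

section \<open>Preservation of the invariant, address by address\<close>

context
  fixes \<alpha> p :: nat and r A :: "nat \<Rightarrow> nat" and b :: bool
  assumes I: "inv \<alpha> p r A" and W: "words r A"
begin

lemma word_bounds:
  "r x < 2 ^ w" "A x < 2 ^ w" "r x mod 2 ^ w = r x" "A x mod 2 ^ w = A x" "n < 2 ^ w" "0 < w" "1 \<le> k" "k \<le> n"
  using W k n w_pos by (auto simp: words_def)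


lemma inv_next_0:
  assumes "p = 0"
  shows "inv_next \<alpha> p r A b"
  using I[unfolded assms inv_def, simplified] word_bounds
  unfolding inv_next_def assms inv_def
  by (elim conjE) (simp add: set_reg_def)

lemma inv_next_1:
  assumes "p = Suc 0"
  shows "inv_next \<alpha> p r A b"
  using I[unfolded assms inv_def, simplified] word_bounds
  unfolding inv_next_def assms inv_def
  by (elim conjE) (simp add: set_reg_def)

lemma inv_next_2:
  assumes "p = 2"
  shows "inv_next \<alpha> p r A b"
  using I[unfolded assms inv_def, simplified] word_bounds
  unfolding inv_next_def assms inv_def
  by (elim conjE) (simp add: set_reg_def)

lemma inv_next_3:
  assumes "p = 3"
  shows "inv_next \<alpha> p r A b"
  using I[unfolded assms inv_def, simplified] word_bounds
  unfolding inv_next_def assms inv_def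
  by (elim conjE) (auto simp: set_reg_def intro: exI[of _ 0])

lemma inv_next_4:
  assumes "p = 4"
  shows "inv_next \<alpha> p r A b"
proof -
  note I' = I[unfolded assms inv_def, simplified]
  then obtain j where j: "j < w" "r 6 = 2 ^ j" "Suc (r 3) = 2 ^ j" by blast
  moreover have "(2 :: nat) ^ Suc j \<le> 2 ^ w" using j by (intro power_increasing) auto
  ultimately have "(r 3 + 2 ^ j) mod 2 ^ w = r 3 + 2 ^ j" by simp
  then show ?thesis
    unfolding inv_next_def assms inv_def using I' j by (auto simp: set_reg_def)
qed

lemma inv_next_5:
  assumes "p = 5"
  shows "inv_next \<alpha> p r A b"
proof -
  note I' = I[unfolded assms inv_def, simplified]
  then obtain j where j: "j < w" "r 6 = 2 ^ j" "Suc (r 3) = 2 * 2 ^ j" by auto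
  have "\<exists>i\<le>w. Suc 0 \<le> i \<and> (2 ^ j + 2 ^ j) mod 2 ^ w = (2 ^ i mod 2 ^ w :: nat) \<and> 2 * 2 ^ j = (2 ^ i :: nat)"
    using j by (intro exI[of _ "Suc j"]) (simp add: mult_2)
  moreover have "r 13 = 0" "r (Suc 0) = k" "r 0 = n" "r 5 = 0" "r 2 = 0" "r 4 = 1" "r 12 = 2 mod 2 ^ w"
    "\<forall>e. close \<alpha> (rank X e) (count_in (\<lambda>v. v \<le> e) A {..<n})"
    using I' by simp_all
  ultimately show ?thesis
    unfolding inv_next_def assms inv_def by (simp add: set_reg_def j)
qed

text \<open>The doubled power wraps to 0 exactly for \<open>j = w\<close>. This ends the loop with
  \<open>2 ^ w - 1\<close> in register 3, so the program finds the largest word without being given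
  \<open>w\<close>.\<close>

lemma inv_next_6:
  assumes "p = 6"
  shows "inv_next \<alpha> p r A b"
proof -
  note I' = I[unfolded assms inv_def, simplified]
  then obtain j where j: "j \<le> w" "1 \<le> j" "r 6 = 2 ^ j mod 2 ^ w" "Suc (r 3) = 2 ^ j" by auto
  show ?thesis
  proof (cases "j = w")
    case True
    then show ?thesis
      unfolding inv_next_def assms inv_def using I' j k limits_init[of "r 3"] by (simp add: segment_def)
  next
    case False
    then have "(2 :: nat) ^ j < 2 ^ w" using j by (intro power_strict_increasing) auto
    then show ?thesis
      unfolding inv_next_def assms inv_def using I' j False by (auto simp: intro!: exI[of _ j])
  qed
qed

lemma inv_next_7:
  assumes "p = 7"
  shows "inv_next \<alpha> p r A b"
  using I[unfolded assms inv_def, simplified] word_bounds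
  unfolding inv_next_def assms inv_def
  by (elim conjE) (simp add: set_reg_def)

lemma inv_next_8:
  assumes "p = 8"
  shows "inv_next \<alpha> p r A b"
  using I[unfolded assms inv_def, simplified] word_bounds
  unfolding inv_next_def assms inv_def
  by (elim conjE) (simp add: set_reg_def floorlog_le_iff)

lemma inv_next_9:
  assumes "p = 9"
  shows "inv_next \<alpha> p r A b"
  using I[unfolded assms inv_def, simplified] word_bounds
  unfolding inv_next_def assms inv_def
  by (elim conjE) (simp add: set_reg_def bits_half algebra_simps)

lemma inv_next_10:
  assumes "p = 10"
  shows "inv_next \<alpha> p r A b"
  using I[unfolded assms inv_def, simplified] word_bounds
      word_mod_eq[of "r 7 + r 7" 2 "bits (r 6 div 2)"]
  unfolding inv_next_def assms inv_def
  by (elim conjE) (simp add: set_reg_def mult_2 add.assoc)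

lemma inv_next_11:
  assumes "p = 11"
  shows "inv_next \<alpha> p r A b"
  using I[unfolded assms inv_def, simplified] word_bounds
      word_mod_eq[of "r 7 + r 8" 1 "bits (r 6 div 2)"]
      mult_right_mono[of "r 7 + r 8 + 1" "r 7 + 2" "2 ^ bits (r 6 div 2)"]
  unfolding inv_next_def assms inv_def
  by (elim conjE) (simp add: set_reg_def)

lemma inv_next_12:
  assumes "p = 12"
  shows "inv_next \<alpha> p r A b"
  using I[unfolded assms inv_def, simplified] word_bounds
      word_half[of "r 6"]
  unfolding inv_next_def assms inv_def
  by (elim conjE) (simp add: set_reg_def)

lemma inv_next_13:
  assumes "p = 13"
  shows "inv_next \<alpha> p r A b"
  using I[unfolded assms inv_def, simplified] word_bounds
  unfolding inv_next_def assms inv_def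
  by (elim conjE) (simp add: set_reg_def)

lemma inv_next_14:
  assumes "p = 14"
  shows "inv_next \<alpha> p r A b"
  using I[unfolded assms inv_def, simplified] word_bounds
      mod_less_divisor[of "r 0" "r 7"] less_trans[of "r 7 mod r 0" "r 0" "2 ^ w"]
  unfolding inv_next_def assms inv_def
  by (elim conjE) (simp add: set_reg_def)

lemma inv_next_15:
  assumes "p = 15"
  shows "inv_next \<alpha> p r A b"
  using I[unfolded assms inv_def, simplified] word_bounds
  unfolding inv_next_def assms inv_def
  by (elim conjE) (simp add: set_reg_def)

lemma inv_next_16:
  assumes "p = 16"
  shows "inv_next \<alpha> p r A b"
  using I[unfolded assms inv_def, simplified] word_bounds
  unfolding inv_next_def assms inv_def
  by (elim conjE) (simp add: set_reg_def)

lemma inv_next_17: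
  assumes "p = 17"
  shows "inv_next \<alpha> p r A b"
  using I[unfolded assms inv_def, simplified] word_bounds
  unfolding inv_next_def assms inv_def
  by (elim conjE) (simp add: set_reg_def)

lemma inv_next_18:
  assumes "p = 18"
  shows "inv_next \<alpha> p r A b"
  using I[unfolded assms inv_def, simplified] word_bounds
  unfolding inv_next_def assms inv_def
  by (elim conjE) (simp add: set_reg_def)

lemma inv_next_19:
  assumes "p = 19"
  shows "inv_next \<alpha> p r A b"
  using I[unfolded assms inv_def, simplified] word_bounds
  unfolding inv_next_def assms inv_def
  by (elim conjE) (simp add: set_reg_def)

lemma inv_next_20:
  assumes "p = 20"
  shows "inv_next \<alpha> p r A b"
  using I[unfolded assms inv_def, simplified] word_bounds
  unfolding inv_next_def assms inv_def
  by (elim conjE) (simp add: set_reg_def)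

lemma inv_next_21:
  assumes "p = 21"
  shows "inv_next \<alpha> p r A b"
  using I[unfolded assms inv_def, simplified] word_bounds
  unfolding inv_next_def assms inv_def
  by (elim conjE) (simp add: set_reg_def)

lemma inv_next_22:
  assumes "p = 22"
  shows "inv_next \<alpha> p r A b"
  using I[unfolded assms inv_def, simplified] word_bounds
      counts_init
  unfolding inv_next_def assms inv_def
  by (elim conjE) (simp add: set_reg_def)

lemma inv_next_23:
  assumes "p = 23"
  shows "inv_next \<alpha> p r A b"
  using I[unfolded assms inv_def, simplified] word_bounds
      counts_load[of "r 6" "r 0" \<alpha> "r 8" A "r 10" "r 11"]
  unfolding inv_next_def assms inv_def
  by (elim conjE) (auto simp: set_reg_def)

lemma inv_next_24:
  assumes "p = 24"
  shows "inv_next \<alpha> p r A b"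
  using I[unfolded assms inv_def, simplified] word_bounds
  unfolding inv_next_def assms inv_def
  by (elim conjE) (simp add: set_reg_def)

lemma inv_next_25:
  assumes "p = 25"
  shows "inv_next \<alpha> p r A b"
  using I[unfolded assms inv_def, simplified] word_bounds
  unfolding inv_next_def assms inv_def
  by (elim conjE) auto

lemma inv_next_26:
  assumes "p = 26"
  shows "inv_next \<alpha> p r A b"
  using I[unfolded assms inv_def, simplified] word_bounds
  unfolding inv_next_def assms inv_def
  by (elim conjE) (simp add: set_reg_def)

lemma inv_next_27:
  assumes "p = 27"
  shows "inv_next \<alpha> p r A b"
  using I[unfolded assms inv_def, simplified] word_bounds
  unfolding inv_next_def assms inv_def
  by (elim conjE) (simp add: set_reg_def)

lemma inv_next_28:
  assumes "p = 28"
  shows "inv_next \<alpha> p r A b"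
  using I[unfolded assms inv_def, simplified] word_bounds
  unfolding inv_next_def assms inv_def
  by (elim conjE) (simp add: set_reg_def)

lemma inv_next_29:
  assumes "p = 29"
  shows "inv_next \<alpha> p r A b"
  using I[unfolded assms inv_def, simplified] word_bounds
  unfolding inv_next_def assms inv_def
  by (elim conjE) (simp add: set_reg_def)

lemma inv_next_30:
  assumes "p = 30"
  shows "inv_next \<alpha> p r A b"
  using I[unfolded assms inv_def, simplified] word_bounds
  unfolding inv_next_def assms inv_def
  by (elim conjE) auto

lemma inv_next_31:
  assumes "p = 31"
  shows "inv_next \<alpha> p r A b"
  using I[unfolded assms inv_def, simplified] word_bounds
      strict_rank_le_rank[of X "r 8"]
  unfolding inv_next_def assms inv_def
  by (elim conjE) (auto simp: close_def)

lemma inv_next_32: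
  assumes "p = 32"
  shows "inv_next \<alpha> p r A b"
  using I[unfolded assms inv_def, simplified] word_bounds
      segment_subset[of "r 2" "r 2" "r 8" "r 3" \<alpha> A]
  unfolding inv_next_def assms inv_def
  by (elim conjE) (simp add: set_reg_def limits_def)

lemma inv_next_33:
  assumes "p = 33"
  shows "inv_next \<alpha> p r A b"
  using I[unfolded assms inv_def, simplified] word_bounds
  unfolding inv_next_def assms inv_def
  by (elim conjE) (simp add: set_reg_def)

text \<open>The strict count is already known to be below \<open>k\<close>. If the other count
  reaches \<open>k\<close>, the pivot is the answer; if not, its rank, and so its strict rank, is
  small enough for a new \<open>lo\<close>.\<close>

lemma inv_next_34:
  assumes "p = 34"
  shows "inv_next \<alpha> p r A b"
  using I[unfolded assms inv_def, simplified] word_bounds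
      strict_rank_le_rank[of X "r 8"]
  unfolding inv_next_def assms inv_def
  by (elim conjE) (auto simp: close_def near_rank_def)

lemma inv_next_35:
  assumes "p = 35"
  shows "inv_next \<alpha> p r A b"
  using I[unfolded assms inv_def, simplified] word_bounds
  unfolding inv_next_def assms inv_def
  by (elim conjE) (simp add: set_reg_def)

lemma inv_next_37:
  assumes "p = 37"
  shows "inv_next \<alpha> p r A b"
  using I[unfolded assms inv_def, simplified] word_bounds
      segment_subset[of "r 2" "r 8" "r 3" "r 3" \<alpha> A]
  unfolding inv_next_def assms inv_def
  by (elim conjE) (simp add: set_reg_def limits_def)

lemma inv_next_38:
  assumes "p = 38"
  shows "inv_next \<alpha> p r A b"
  using I[unfolded assms inv_def, simplified] word_bounds
  unfolding inv_next_def assms inv_def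
  by (elim conjE) (simp add: set_reg_def)

lemma inv_next_39:
  assumes "p = 39"
  shows "inv_next \<alpha> p r A b"
  using I[unfolded assms inv_def, simplified] word_bounds
  unfolding inv_next_def assms inv_def
  by (elim conjE) (simp add: set_reg_def atLeast0LessThan)

lemma inv_next_40:
  assumes "p = 40"
  shows "inv_next \<alpha> p r A b"
  using I[unfolded assms inv_def, simplified] word_bounds
      segment_load
  unfolding inv_next_def assms inv_def
  by (elim conjE) (simp add: set_reg_def)

lemma inv_next_41:
  assumes "p = 41"
  shows "inv_next \<alpha> p r A b"
  using I[unfolded assms inv_def, simplified] word_bounds
  unfolding inv_next_def assms inv_def
  by (elim conjE) (simp add: set_reg_def)

lemma inv_next_42:
  assumes "p = 42"
  shows "inv_next \<alpha> p r A b"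
  using I[unfolded assms inv_def, simplified] word_bounds
      segment_with_below
  unfolding inv_next_def assms inv_def
  by (elim conjE) (simp add: set_reg_def)

lemma inv_next_43:
  assumes "p = 43"
  shows "inv_next \<alpha> p r A b"
  using I[unfolded assms inv_def, simplified] word_bounds
  unfolding inv_next_def assms inv_def
  by (elim conjE) (simp add: set_reg_def)

lemma inv_next_44:
  assumes "p = 44"
  shows "inv_next \<alpha> p r A b"
  using I[unfolded assms inv_def, simplified] word_bounds
      segment_with_above
  unfolding inv_next_def assms inv_def
  by (elim conjE) (simp add: not_less)

lemma inv_next_45:
  assumes "p = 45"
  shows "inv_next \<alpha> p r A b"
  using I[unfolded assms inv_def, simplified] word_bounds
  unfolding inv_next_def assms inv_def
  by (elim conjE) (simp add: set_reg_def)

lemma inv_next_46: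
  assumes "p = 46"
  shows "inv_next \<alpha> p r A b"
  using I[unfolded assms inv_def, simplified] word_bounds
      segment_with_store
  unfolding inv_next_def assms inv_def
  by (elim conjE) (simp add: set_reg_def)

lemma inv_next_47:
  assumes "p = 47"
  shows "inv_next \<alpha> p r A b"
  using I[unfolded assms inv_def, simplified] word_bounds
  unfolding inv_next_def assms inv_def
  by (elim conjE) (simp add: set_reg_def)

lemma inv_next_48:
  assumes "p = 48"
  shows "inv_next \<alpha> p r A b"
  using I[unfolded assms inv_def, simplified] word_bounds
      le_less_trans[of "Suc (r 6)" "r 0" "2 ^ w"]
  unfolding inv_next_def assms inv_def
  by (elim conjE) (simp add: set_reg_def)

lemma inv_next_49:
  assumes "p = 49"
  shows "inv_next \<alpha> p r A b"
  using I[unfolded assms inv_def, simplified] word_bounds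
  unfolding inv_next_def assms inv_def
  by (elim conjE) (auto simp: not_less)

lemma inv_next_50:
  assumes "p = 50"
  shows "inv_next \<alpha> p r A b"
  using I[unfolded assms inv_def, simplified] word_bounds
  unfolding inv_next_def assms inv_def
  by (elim conjE) (simp add: set_reg_def)

lemma inv_next_51:
  assumes "p = 51"
  shows "inv_next \<alpha> p r A b"
  using I[unfolded assms inv_def, simplified] word_bounds
      near_rank_lo
  unfolding inv_next_def assms inv_def
  by (elim conjE) auto

lemma inv_next_52:
  assumes "p = 52"
  shows "inv_next \<alpha> p r A b"
  using I[unfolded assms inv_def, simplified] word_bounds
  unfolding inv_next_def assms inv_def
  by (elim conjE) (simp add: set_reg_def)

lemma inv_next_54:
  assumes "p = 54"
  shows "inv_next \<alpha> p r A b"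
  using I[unfolded assms inv_def, simplified] word_bounds
  unfolding inv_next_def assms inv_def
  by (elim conjE) (simp add: set_reg_def)

lemma inv_next_55:
  assumes "p = 55"
  shows "inv_next \<alpha> p r A b"
  using I[unfolded assms inv_def, simplified] word_bounds
      near_rank_hi
  unfolding inv_next_def assms inv_def
  by (elim conjE) auto

lemma inv_next_56:
  assumes "p = 56"
  shows "inv_next \<alpha> p r A b"
  using I[unfolded assms inv_def, simplified] word_bounds
  unfolding inv_next_def assms inv_def
  by (elim conjE) (simp add: set_reg_def)

lemma inv_next_57:
  assumes "p = 57"
  shows "inv_next \<alpha> p r A b"
  using I[unfolded assms inv_def, simplified] word_bounds
  unfolding inv_next_def assms inv_def
  by (elim conjE) (simp add: set_reg_def)

lemma inv_next:
  assumes "p \<notin> {36, 53, 58}"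
  shows "inv_next \<alpha> p r A b"
proof -
  have "p \<in> {..<59}" using I by (simp add: inv_def)
  with assms show ?thesis
    unfolding lessThan_59 by (elim insertE emptyE)
      (erule
        inv_next_0 inv_next_1 inv_next_2 inv_next_3 inv_next_4 inv_next_5 inv_next_6 inv_next_7
        inv_next_8 inv_next_9 inv_next_10 inv_next_11 inv_next_12 inv_next_13 inv_next_14
        inv_next_15 inv_next_16 inv_next_17 inv_next_18 inv_next_19 inv_next_20 inv_next_21
        inv_next_22 inv_next_23 inv_next_24 inv_next_25 inv_next_26 inv_next_27 inv_next_28
        inv_next_29 inv_next_30 inv_next_31 inv_next_32 inv_next_33 inv_next_34 inv_next_35
        inv_next_37 inv_next_38 inv_next_39 inv_next_40 inv_next_41 inv_next_42 inv_next_43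
        inv_next_44 inv_next_45 inv_next_46 inv_next_47 inv_next_48 inv_next_49 inv_next_50
        inv_next_51 inv_next_52 inv_next_54 inv_next_55 inv_next_56 inv_next_57 | simp)+
qed

end
end

section \<open>Effect of corruptions on the invariant\<close>

lemma close_perturb:
  assumes "close \<alpha> a (c + count_in Q A S)" "finite S" "finite D" "\<And>x. x \<notin> D \<Longrightarrow> A' x = A x"
  shows "close (\<alpha> + card D) a (c + count_in Q A' S)"
  using assms count_in_perturb[of S D A' A Q] count_in_perturb[of S D A A' Q]
  by (simp add: close_def)

lemma near_rank_mono: "near_rank \<alpha> Y i e \<Longrightarrow> near_rank (\<alpha> + d) Y i e"
  by (simp add: near_rank_def)

context instance_of_selection begin

lemma limits_mono: "limits \<alpha> lo hi \<Longrightarrow> limits (\<alpha> + d) lo hi"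
  by (simp add: limits_def)

text \<open>Every atom of \<open>inv\<close> involving the memory or \<open>\<alpha>\<close> occurs
  positively and survives when the slack grows by the number of changed cells; the others concern
  registers only.\<close>

lemma inv_perturb:
  assumes "inv \<alpha> p r A" and D: "finite D" "\<And>x. x \<notin> D \<Longrightarrow> A' x = A x"
  shows "inv (\<alpha> + card D) p r A'"
proof -
  let ?\<beta> = "\<alpha> + card D"
  have 1: "segment \<alpha> lo hi A c S \<longrightarrow> segment ?\<beta> lo hi A' c S" if "finite S" for lo hi c S
    using close_perturb[OF _ that D] by (simp add: segment_def)
  have 2: "segment_with v \<alpha> lo hi A c S \<longrightarrow> segment_with v ?\<beta> lo hi A' c S" if "finite S" for v lo hi c S
    using close_perturb[OF _ that D] by (simp add: segment_with_def)
  have 3: "counts \<alpha> q A L E S \<longrightarrow> counts ?\<beta> q A' L E S" if "finite S" for q L E S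
    using close_perturb[OF _ that D] by (simp add: counts_def)
  have 4: "(\<forall>e. close \<alpha> (rank X e) (count_in (\<lambda>v. v \<le> e) A {..<n})) \<longrightarrow>
      (\<forall>e. close ?\<beta> (rank X e) (count_in (\<lambda>v. v \<le> e) A' {..<n}))"
    using close_perturb[OF _ _ D, of \<alpha> _ 0] by simp
  have 5: "x \<le> y + \<alpha> \<longrightarrow> x \<le> y + ?\<beta>" for x y :: nat by simp
  have 6: "near_rank \<alpha> X k e \<longrightarrow> near_rank ?\<beta> X k e" for e by (simp add: near_rank_mono)
  have 7: "limits \<alpha> lo hi \<longrightarrow> limits ?\<beta> lo hi" for lo hi by (simp add: limits_mono)
  have "inv \<alpha> p r A \<longrightarrow> inv ?\<beta> p r A'"
    unfolding inv_def
    by (intro imp_refl 1 2 3 4 5 6 7 conj_mono imp_mono finite_lessThan finite_UnI finite_atLeastLessThan finite.emptyI)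
  then show ?thesis using assms by blast
qed

section \<open>The potential\<close>

text \<open>
  The pivot is read from the memory \<open>B\<close> when all its coins have been tossed. As \<open>B\<close> depends on the
  adversary but not on these coins, the potential averages over them from the beginning of the
  choice; later on it only depends on the current memory.
\<close>

definition potential :: "(nat \<Rightarrow> nat) \<Rightarrow> nat \<Rightarrow> (nat \<Rightarrow> nat) \<Rightarrow> (nat \<Rightarrow> nat) \<Rightarrow> real" where
  "potential B p r A = (let
      m = real (r 0); j = real (r 7); u = real (r 0 - r 6);
      choice = (\<lambda>q R. 1024 * coin_mean (\<lambda>R. larger_side B (r 0) (B (R mod r 0))) q R + 14 * m + 5 * real (bits q));
      side = 1024 * larger_side A (r 0) (r 8);
      inner = (\<lambda>S. 1024 * real (count_in (\<lambda>v. r 2 < v \<and> v < r 3) A S))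
    in
      if p \<le> 6 then 1024 * real n + 3 * real (w - bits (r 3)) + real (if p \<le> 4 then 4 - p else 7 - p)
      else if p = 7 then 1024 * m
      else if p = 8 then real (1024 * r 0 - 1)
      else if p = 9 then choice (r 6) (r 7) + 23
      else if p = 10 then choice (r 6 div 2) (2 * r 7 + r 8) + 27
      else if p = 11 then choice (r 6 div 2) (r 7 + r 8) + 26
      else if p = 12 then choice (r 6 div 2) (r 7) + 25
      else if p = 13 then choice (r 6) (r 7) + 24
      else if p = 14 then choice 0 (r 7) + 23
      else if p = 15 then choice 0 (r 7) + 22
      else if p = 16 then side + 14 * m + 21
      else if p = 17 \<or> p = 19 then inner {..<r 0} + 7 * m + 12
      else if p = 18 then side + 14 * m + 20
      else if p \<le> 22 then side + 14 * m + real (39 - p)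
      else if p \<le> 26 then side + 7 * m + 7 * u + real (39 - p)
      else if p \<le> 29 then side + 7 * m + 7 * u + real (40 - p)
      else if p = 30 then side + 7 * m + 7 * u + 17
      else if p = 31 then side + 7 * m + 14
      else if p = 32 \<or> p = 34 then side + 7 * m + 13
      else if p = 33 then inner {..<r 0} + 7 * m + 12
      else if p = 35 \<or> p = 37 then side + 7 * m + 12
      else if p = 38 then inner {..<r 0} + 7 * m + 10
      else if p = 39 then inner {..<r 0} + 7 * m + 9
      else if p = 40 then 1024 * j + inner {r 6..<r 0} + 7 * u + 8
      else if p = 41 then 1024 * (j + of_bool (r 2 < r 9 \<and> r 9 < r 3)) + inner {Suc (r 6)..<r 0} + 7 * u + 7
      else if p = 42 then 1024 * j + inner {Suc (r 6)..<r 0} + 7 * u + 6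
      else if p = 43 \<or> p = 45 then 1024 * j + inner {Suc (r 6)..<r 0} + 7 * u + 5
      else if p = 44 then 1024 * (j + of_bool (r 9 < r 3)) + inner {Suc (r 6)..<r 0} + 7 * u + 6
      else if p = 46 then 1024 * (j + 1) + inner {Suc (r 6)..<r 0} + 7 * u + 5
      else if p = 47 then 1024 * (j + 1) + inner {Suc (r 6)..<r 0} + 7 * u + 4
      else if p = 48 then 1024 * j + inner {Suc (r 6)..<r 0} + 7 * u + 3
      else if p = 49 then 1024 * j + inner {r 6..<r 0} + 7 * u + 9
      else if p = 50 then 1024 * j + 8
      else if p = 51 then 1024 * m + 7
      else if p = 54 \<or> p = 55 \<or> p = 56 then 1024 * m + real (60 - p)
      else if p = 52 \<or> p = 57 then 1
      else 0)"

text \<open>\<open>B\<close> stays fixed, so while the pivot is being chosen there is nothing to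
  pay. Elsewhere each case contains at most one count over the current memory, with weight
  1024.\<close>

lemma potential_perturb:
  assumes D: "finite D" "\<And>x. x \<notin> D \<Longrightarrow> A' x = A x"
  shows "potential B p r A' \<le> potential B p r A + 1024 * real (card D)"
proof -
  have side: "larger_side A' (r 0) (r 8) \<le> larger_side A (r 0) (r 8) + real (card D)"
    using larger_side_perturb[of D A' A, OF D] .
  have inner: "real (count_in (\<lambda>v. r 2 < v \<and> v < r 3) A' S) \<le>
      real (count_in (\<lambda>v. r 2 < v \<and> v < r 3) A S) + real (card D)" if "finite S" for S
    using count_in_perturb[of S D A' A, OF that D] by (metis of_nat_add of_nat_le_iff)
  have if_le: "a \<le> a' + d \<Longrightarrow> c \<le> c' + d \<Longrightarrow> (if P then a else c) \<le> (if P then a' else c') + d"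
    for P and a a' c c' d :: real by simp
  show ?thesis
    using side inner[of "{..<r 0}"] inner[of "{r 6..<r 0}"] inner[of "{Suc (r 6)..<r 0}"]
    unfolding potential_def Let_def by (intro if_le; simp del: of_nat_diff)
qed

lemma coin_mean_nonneg: "(\<And>x. 0 \<le> f x) \<Longrightarrow> 0 \<le> coin_mean f q R"
  by (simp add: coin_mean_eq_sum sum_nonneg)

lemma larger_side_nonneg: "0 \<le> larger_side A m p"
  by (simp add: larger_side_def)

text \<open>No invariant is assumed: the differences in \<open>potential\<close> are formed in the
  naturals before conversion.\<close>

lemma potential_nonneg: "0 \<le> potential B p r A"
proof -
  have "0 \<le> larger_side A (r 0) (r 8)" "0 \<le> larger_side B (r 0) (B (R mod r 0))" for R
    by (simp_all add: larger_side_nonneg)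
  moreover have "0 \<le> coin_mean (\<lambda>R. larger_side B (r 0) (B (R mod r 0))) q R" for q R
    by (intro coin_mean_nonneg larger_side_nonneg)
  moreover have if_nonneg: "0 \<le> a \<Longrightarrow> 0 \<le> c \<Longrightarrow> 0 \<le> (if P then a else c)" for P and a c :: real
    by simp
  ultimately show ?thesis
    unfolding potential_def Let_def
    by (intro if_nonneg add_nonneg_nonneg mult_nonneg_nonneg; simp)
qed


definition potential_next :: "(nat \<Rightarrow> nat) \<Rightarrow> nat \<Rightarrow> (nat \<Rightarrow> nat) \<Rightarrow> (nat \<Rightarrow> nat) \<Rightarrow> bool \<Rightarrow> real" where
  "potential_next B p r A b =
     (let s = exec w b (prog ! p) \<lparr>pc = p, regs = r, mem = A\<rparr> in potential B (pc s) (regs s) (mem s))"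

text \<open>The number of steps until the pivot has been loaded, 0 outside the choice of the pivot.\<close>

definition time_to_load :: "nat \<Rightarrow> (nat \<Rightarrow> nat) \<Rightarrow> nat" where
  "time_to_load p r =
     (if p = 9 then 5 * bits (r 6) + 2 else if p = 10 then 5 * bits (r 6 div 2) + 6
      else if p = 11 then 5 * bits (r 6 div 2) + 5 else if p = 12 then 5 * bits (r 6 div 2) + 4
      else if p = 13 then 5 * bits (r 6) + 3 else if p = 14 then 2 else if p = 15 then 1 else 0)"

text \<open>An open interval that does not contain \<open>p\<close> lies on one side of it. This
  covers rejected pivots as well as a pivot that has become an end of the interval.\<close>

lemma inner_le_larger_side:
  assumes "lo \<ge> p \<or> hi \<le> p"
  shows "real (count_in (\<lambda>v. lo < v \<and> v < hi) A {..<m}) \<le> larger_side A m p"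
proof -
  have "count_in (\<lambda>v. lo < v \<and> v < hi) A {..<m} \<le> count_in (\<lambda>v. p < v) A {..<m}" if "p \<le> lo"
    using that by (intro count_in_mono) auto
  moreover have "count_in (\<lambda>v. lo < v \<and> v < hi) A {..<m} \<le> count_in (\<lambda>v. v < p) A {..<m}" if "hi \<le> p"
    using that by (intro count_in_mono) auto
  ultimately show ?thesis
    using assms by (auto simp: larger_side_def le_max_iff_disj)
qed

section \<open>Decrease of the potential, address by address\<close>

context
  fixes \<alpha> p :: nat and r A B B' :: "nat \<Rightarrow> nat" and b :: bool
  assumes I: "inv \<alpha> p r A" and W: "words r A"
    and B: "p = 15 \<Longrightarrow> B = A" and B': "10 \<le> p \<Longrightarrow> p \<le> 14 \<Longrightarrow> B' = B"
begin

lemma potential_next_0: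
  assumes "p = 0"
  shows "1 + potential_next B' p r A b \<le> potential B p r A"
  using I[unfolded assms inv_def, simplified] word_bounds[OF I W]
  unfolding potential_next_def assms
  by (elim conjE) (simp add: potential_def Let_def set_reg_def)

lemma potential_next_1:
  assumes "p = Suc 0"
  shows "1 + potential_next B' p r A b \<le> potential B p r A"
  using I[unfolded assms inv_def, simplified] word_bounds[OF I W]
  unfolding potential_next_def assms
  by (elim conjE) (simp add: potential_def Let_def set_reg_def)

lemma potential_next_2:
  assumes "p = 2"
  shows "1 + potential_next B' p r A b \<le> potential B p r A"
  using I[unfolded assms inv_def, simplified] word_bounds[OF I W]
  unfolding potential_next_def assms
  by (elim conjE) (simp add: potential_def Let_def set_reg_def)

lemma potential_next_3:
  assumes "p = 3"
  shows "1 + potential_next B' p r A b \<le> potential B p r A"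
  using I[unfolded assms inv_def, simplified] word_bounds[OF I W]
  unfolding potential_next_def assms
  by (elim conjE) (simp add: potential_def Let_def set_reg_def)

text \<open>Register 3 has the form \<open>2 ^ j - 1\<close> with exactly \<open>j\<close> bits; the
  bit gained here pays for the three instructions of the loop.\<close>

lemma potential_next_4:
  assumes "p = 4"
  shows "1 + potential_next B' p r A b \<le> potential B p r A"
proof -
  note I' = I[unfolded assms inv_def, simplified]
  then obtain j where j: "j < w" "r 6 = 2 ^ j" "Suc (r 3) = 2 ^ j" by blast
  moreover have "(2 :: nat) ^ Suc j \<le> 2 ^ w" using j by (intro power_increasing) auto
  ultimately have less: "Suc (2 * r 3) < 2 ^ w" and sum: "r 3 + r 6 = Suc (2 * r 3)" by simp_all
  have bits: "bits (Suc (2 * r 3)) = Suc (bits (r 3))" by (subst bits_half) simp_all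
  have "bits (Suc (2 * r 3)) \<le> w" using less by (simp add: floorlog_le_iff)
  then have "real (w - bits (r 3)) = 1 + real (w - bits ((r 3 + r 6) mod 2 ^ w))"
    using less by (simp add: sum bits)
  then show ?thesis
    unfolding potential_next_def assms using I'
    by (simp add: potential_def Let_def set_reg_def)
qed

lemma potential_next_5:
  assumes "p = 5"
  shows "1 + potential_next B' p r A b \<le> potential B p r A"
  using I[unfolded assms inv_def, simplified] word_bounds[OF I W]
  unfolding potential_next_def assms
  by (elim conjE) (simp add: potential_def Let_def set_reg_def)

lemma potential_next_6:
  assumes "p = 6"
  shows "1 + potential_next B' p r A b \<le> potential B p r A"
  using I[unfolded assms inv_def, simplified] word_bounds[OF I W]
  unfolding potential_next_def assms
  by (elim conjE) (simp add: potential_def Let_def set_reg_def)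

lemma potential_next_7:
  assumes "p = 7"
  shows "1 + potential_next B' p r A b \<le> potential B p r A"
  using I[unfolded assms inv_def, simplified] word_bounds[OF I W]
  unfolding potential_next_def assms
  by (elim conjE) (simp add: potential_def Let_def set_reg_def)

text \<open>The one step that uses randomness of the pivot. The mean bound holds for every memory,
  so \<open>B'\<close> may be whatever the adversary prepares for the time of reading. The
  inequality needed is \<open>979 * m + 25 \<le> 1024 * m\<close> for
  \<open>m \<ge> 1\<close>.\<close>

lemma potential_next_8:
  assumes "p = 8"
  shows "1 + potential_next B' p r A b \<le> potential B p r A"
  using I[unfolded assms inv_def, simplified] word_bounds[OF I W]
      mean_larger_side[of "r 0" B'] bits_le[of "r 0"]
  unfolding potential_next_def assms
  by (elim conjE) (simp add: potential_def Let_def set_reg_def)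

lemma potential_next_10:
  assumes "p = 10"
  shows "1 + potential_next B' p r A b \<le> potential B p r A"
  using I[unfolded assms inv_def, simplified] word_bounds[OF I W] B'[unfolded assms, simplified]
      word_mod_eq[of "r 7 + r 7" 2 "bits (r 6 div 2)"]
  unfolding potential_next_def assms
  by (elim conjE) (simp add: potential_def Let_def set_reg_def mult_2 add.assoc)

lemma potential_next_11:
  assumes "p = 11"
  shows "1 + potential_next B' p r A b \<le> potential B p r A"
  using I[unfolded assms inv_def, simplified] word_bounds[OF I W] B'[unfolded assms, simplified]
      word_mod_eq[of "r 7 + r 8" 1 "bits (r 6 div 2)"]
      mult_right_mono[of "r 7 + r 8 + 1" "r 7 + 2" "2 ^ bits (r 6 div 2)"]
  unfolding potential_next_def assms
  by (elim conjE) (simp add: potential_def Let_def set_reg_def)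

lemma potential_next_12:
  assumes "p = 12"
  shows "1 + potential_next B' p r A b \<le> potential B p r A"
  using I[unfolded assms inv_def, simplified] word_bounds[OF I W] B'[unfolded assms, simplified]
      word_half[of "r 6"]
  unfolding potential_next_def assms
  by (elim conjE) (simp add: potential_def Let_def set_reg_def)

lemma potential_next_13:
  assumes "p = 13"
  shows "1 + potential_next B' p r A b \<le> potential B p r A"
  using I[unfolded assms inv_def, simplified] word_bounds[OF I W] B'[unfolded assms, simplified]
  unfolding potential_next_def assms
  by (elim conjE) (simp add: potential_def Let_def set_reg_def)

lemma potential_next_14:
  assumes "p = 14"
  shows "1 + potential_next B' p r A b \<le> potential B p r A"
  using I[unfolded assms inv_def, simplified] word_bounds[OF I W] B'[unfolded assms, simplified]
      mod_less_divisor[of "r 0" "r 7"] less_trans[of "r 7 mod r 0" "r 0" "2 ^ w"]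
  unfolding potential_next_def assms
  by (elim conjE) (simp add: potential_def Let_def set_reg_def)

lemma potential_next_15:
  assumes "p = 15"
  shows "1 + potential_next B' p r A b \<le> potential B p r A"
  using I[unfolded assms inv_def, simplified] word_bounds[OF I W] B[OF assms]
  unfolding potential_next_def assms
  by (elim conjE) (simp add: potential_def Let_def set_reg_def)

lemma potential_next_16:
  assumes "p = 16"
  shows "1 + potential_next B' p r A b \<le> potential B p r A"
  using I[unfolded assms inv_def, simplified] word_bounds[OF I W]
      inner_le_larger_side[of "r 8" "r 2" "r 3" A "r 0"]
  unfolding potential_next_def assms
  by (elim conjE) (cases "r 2 < r 8"; simp add: potential_def Let_def set_reg_def)

lemma potential_next_17:
  assumes "p = 17"
  shows "1 + potential_next B' p r A b \<le> potential B p r A"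
  using I[unfolded assms inv_def, simplified] word_bounds[OF I W]
  unfolding potential_next_def assms
  by (elim conjE) (simp add: potential_def Let_def set_reg_def)

lemma potential_next_18:
  assumes "p = 18"
  shows "1 + potential_next B' p r A b \<le> potential B p r A"
  using I[unfolded assms inv_def, simplified] word_bounds[OF I W]
      inner_le_larger_side[of "r 8" "r 2" "r 3" A "r 0"]
  unfolding potential_next_def assms
  by (elim conjE) (cases "r 8 < r 3"; simp add: potential_def Let_def set_reg_def)

lemma potential_next_19:
  assumes "p = 19"
  shows "1 + potential_next B' p r A b \<le> potential B p r A"
  using I[unfolded assms inv_def, simplified] word_bounds[OF I W]
  unfolding potential_next_def assms
  by (elim conjE) (simp add: potential_def Let_def set_reg_def)

lemma potential_next_20:
  assumes "p = 20"
  shows "1 + potential_next B' p r A b \<le> potential B p r A"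
  using I[unfolded assms inv_def, simplified] word_bounds[OF I W]
  unfolding potential_next_def assms
  by (elim conjE) (simp add: potential_def Let_def set_reg_def)

lemma potential_next_21:
  assumes "p = 21"
  shows "1 + potential_next B' p r A b \<le> potential B p r A"
  using I[unfolded assms inv_def, simplified] word_bounds[OF I W]
  unfolding potential_next_def assms
  by (elim conjE) (simp add: potential_def Let_def set_reg_def)

lemma potential_next_22:
  assumes "p = 22"
  shows "1 + potential_next B' p r A b \<le> potential B p r A"
  using I[unfolded assms inv_def, simplified] word_bounds[OF I W]
  unfolding potential_next_def assms
  by (elim conjE) (simp add: potential_def Let_def set_reg_def)

lemma potential_next_23:
  assumes "p = 23"
  shows "1 + potential_next B' p r A b \<le> potential B p r A"
  using I[unfolded assms inv_def, simplified] word_bounds[OF I W]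
  unfolding potential_next_def assms
  by (elim conjE) (simp add: potential_def Let_def set_reg_def)

lemma potential_next_24:
  assumes "p = 24"
  shows "1 + potential_next B' p r A b \<le> potential B p r A"
  using I[unfolded assms inv_def, simplified] word_bounds[OF I W]
  unfolding potential_next_def assms
  by (elim conjE) (simp add: potential_def Let_def set_reg_def)

lemma potential_next_25:
  assumes "p = 25"
  shows "1 + potential_next B' p r A b \<le> potential B p r A"
  using I[unfolded assms inv_def, simplified] word_bounds[OF I W]
  unfolding potential_next_def assms
  by (elim conjE) (simp add: potential_def Let_def set_reg_def)

lemma potential_next_26:
  assumes "p = 26"
  shows "1 + potential_next B' p r A b \<le> potential B p r A"
  using I[unfolded assms inv_def, simplified] word_bounds[OF I W]
  unfolding potential_next_def assms
  by (elim conjE) (simp add: potential_def Let_def set_reg_def)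

lemma potential_next_27:
  assumes "p = 27"
  shows "1 + potential_next B' p r A b \<le> potential B p r A"
  using I[unfolded assms inv_def, simplified] word_bounds[OF I W]
  unfolding potential_next_def assms
  by (elim conjE) (simp add: potential_def Let_def set_reg_def)

lemma potential_next_28:
  assumes "p = 28"
  shows "1 + potential_next B' p r A b \<le> potential B p r A"
  using I[unfolded assms inv_def, simplified] word_bounds[OF I W]
  unfolding potential_next_def assms
  by (elim conjE) (simp add: potential_def Let_def set_reg_def)

lemma potential_next_29:
  assumes "p = 29"
  shows "1 + potential_next B' p r A b \<le> potential B p r A"
  using I[unfolded assms inv_def, simplified] word_bounds[OF I W]
  unfolding potential_next_def assms
  by (elim conjE) (simp add: potential_def Let_def set_reg_def)

lemma potential_next_30:
  assumes "p = 30"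
  shows "1 + potential_next B' p r A b \<le> potential B p r A"
  using I[unfolded assms inv_def, simplified] word_bounds[OF I W]
  unfolding potential_next_def assms
  by (elim conjE) (simp add: potential_def Let_def set_reg_def)

lemma potential_next_31:
  assumes "p = 31"
  shows "1 + potential_next B' p r A b \<le> potential B p r A"
  using I[unfolded assms inv_def, simplified] word_bounds[OF I W]
  unfolding potential_next_def assms
  by (elim conjE) (simp add: potential_def Let_def set_reg_def)

lemma potential_next_32:
  assumes "p = 32"
  shows "1 + potential_next B' p r A b \<le> potential B p r A"
  using I[unfolded assms inv_def, simplified] word_bounds[OF I W]
      inner_le_larger_side[of "r 8" "r 2" "r 8" A "r 0"]
  unfolding potential_next_def assms
  by (elim conjE) (simp add: potential_def Let_def set_reg_def)

lemma potential_next_33: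
  assumes "p = 33"
  shows "1 + potential_next B' p r A b \<le> potential B p r A"
  using I[unfolded assms inv_def, simplified] word_bounds[OF I W]
  unfolding potential_next_def assms
  by (elim conjE) (simp add: potential_def Let_def set_reg_def)

lemma potential_next_34:
  assumes "p = 34"
  shows "1 + potential_next B' p r A b \<le> potential B p r A"
  using I[unfolded assms inv_def, simplified] word_bounds[OF I W]
  unfolding potential_next_def assms
  by (elim conjE) (simp add: potential_def Let_def set_reg_def)

lemma potential_next_35:
  assumes "p = 35"
  shows "1 + potential_next B' p r A b \<le> potential B p r A"
  using I[unfolded assms inv_def, simplified] word_bounds[OF I W]
      larger_side_nonneg[of A "r 0" "r 8"]
  unfolding potential_next_def assms
  by (elim conjE) (simp add: potential_def Let_def set_reg_def)

lemma potential_next_37: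
  assumes "p = 37"
  shows "1 + potential_next B' p r A b \<le> potential B p r A"
  using I[unfolded assms inv_def, simplified] word_bounds[OF I W]
      inner_le_larger_side[of "r 8" "r 8" "r 3" A "r 0"]
  unfolding potential_next_def assms
  by (elim conjE) (simp add: potential_def Let_def set_reg_def)

lemma potential_next_38:
  assumes "p = 38"
  shows "1 + potential_next B' p r A b \<le> potential B p r A"
  using I[unfolded assms inv_def, simplified] word_bounds[OF I W]
  unfolding potential_next_def assms
  by (elim conjE) (simp add: potential_def Let_def set_reg_def)

lemma potential_next_39:
  assumes "p = 39"
  shows "1 + potential_next B' p r A b \<le> potential B p r A"
  using I[unfolded assms inv_def, simplified] word_bounds[OF I W]
  unfolding potential_next_def assms
  by (elim conjE) (simp add: potential_def Let_def set_reg_def atLeast0LessThan)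

text \<open>Kept entries are charged in full through \<open>r 7\<close>, whatever their cells
  contain later, so the scan ends with the amount from which the next round starts.\<close>

lemma potential_next_40:
  assumes "p = 40"
  shows "1 + potential_next B' p r A b \<le> potential B p r A"
  using I[unfolded assms inv_def, simplified] word_bounds[OF I W]
  unfolding potential_next_def assms
  by (elim conjE) (simp add: potential_def Let_def set_reg_def atLeastLessThan_insert)

lemma potential_next_41:
  assumes "p = 41"
  shows "1 + potential_next B' p r A b \<le> potential B p r A"
  using I[unfolded assms inv_def, simplified] word_bounds[OF I W]
  unfolding potential_next_def assms
  by (elim conjE) (simp add: potential_def Let_def set_reg_def)

lemma potential_next_42:
  assumes "p = 42"
  shows "1 + potential_next B' p r A b \<le> potential B p r A"
  using I[unfolded assms inv_def, simplified] word_bounds[OF I W]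
  unfolding potential_next_def assms
  by (elim conjE) (simp add: potential_def Let_def set_reg_def)

lemma potential_next_43:
  assumes "p = 43"
  shows "1 + potential_next B' p r A b \<le> potential B p r A"
  using I[unfolded assms inv_def, simplified] word_bounds[OF I W]
  unfolding potential_next_def assms
  by (elim conjE) (simp add: potential_def Let_def set_reg_def)

lemma potential_next_44:
  assumes "p = 44"
  shows "1 + potential_next B' p r A b \<le> potential B p r A"
  using I[unfolded assms inv_def, simplified] word_bounds[OF I W]
  unfolding potential_next_def assms
  by (elim conjE) (simp add: potential_def Let_def set_reg_def)

lemma potential_next_45:
  assumes "p = 45"
  shows "1 + potential_next B' p r A b \<le> potential B p r A"
  using I[unfolded assms inv_def, simplified] word_bounds[OF I W]
  unfolding potential_next_def assms
  by (elim conjE) (simp add: potential_def Let_def set_reg_def)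

lemma potential_next_46:
  assumes "p = 46"
  shows "1 + potential_next B' p r A b \<le> potential B p r A"
  using I[unfolded assms inv_def, simplified] word_bounds[OF I W]
  unfolding potential_next_def assms
  by (elim conjE) (simp add: potential_def Let_def set_reg_def count_in_fun_upd)

lemma potential_next_47:
  assumes "p = 47"
  shows "1 + potential_next B' p r A b \<le> potential B p r A"
  using I[unfolded assms inv_def, simplified] word_bounds[OF I W]
  unfolding potential_next_def assms
  by (elim conjE) (simp add: potential_def Let_def set_reg_def)

lemma potential_next_48:
  assumes "p = 48"
  shows "1 + potential_next B' p r A b \<le> potential B p r A"
  using I[unfolded assms inv_def, simplified] word_bounds[OF I W]
      le_less_trans[of "Suc (r 6)" "r 0" "2 ^ w"]
  unfolding potential_next_def assms
  by (elim conjE) (simp add: potential_def Let_def set_reg_def)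

lemma potential_next_49:
  assumes "p = 49"
  shows "1 + potential_next B' p r A b \<le> potential B p r A"
  using I[unfolded assms inv_def, simplified] word_bounds[OF I W]
  unfolding potential_next_def assms
  by (elim conjE) (simp add: potential_def Let_def set_reg_def)

lemma potential_next_50:
  assumes "p = 50"
  shows "1 + potential_next B' p r A b \<le> potential B p r A"
  using I[unfolded assms inv_def, simplified] word_bounds[OF I W]
  unfolding potential_next_def assms
  by (elim conjE) (simp add: potential_def Let_def set_reg_def)

lemma potential_next_51:
  assumes "p = 51"
  shows "1 + potential_next B' p r A b \<le> potential B p r A"
  using I[unfolded assms inv_def, simplified] word_bounds[OF I W]
  unfolding potential_next_def assms
  by (elim conjE) (simp add: potential_def Let_def set_reg_def)

lemma potential_next_52:
  assumes "p = 52"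
  shows "1 + potential_next B' p r A b \<le> potential B p r A"
  using I[unfolded assms inv_def, simplified] word_bounds[OF I W]
  unfolding potential_next_def assms
  by (elim conjE) (simp add: potential_def Let_def set_reg_def)

lemma potential_next_54:
  assumes "p = 54"
  shows "1 + potential_next B' p r A b \<le> potential B p r A"
  using I[unfolded assms inv_def, simplified] word_bounds[OF I W]
  unfolding potential_next_def assms
  by (elim conjE) (simp add: potential_def Let_def set_reg_def)

lemma potential_next_55:
  assumes "p = 55"
  shows "1 + potential_next B' p r A b \<le> potential B p r A"
  using I[unfolded assms inv_def, simplified] word_bounds[OF I W]
  unfolding potential_next_def assms
  by (elim conjE) (simp add: potential_def Let_def set_reg_def)

lemma potential_next_56:
  assumes "p = 56"
  shows "1 + potential_next B' p r A b \<le> potential B p r A"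
  using I[unfolded assms inv_def, simplified] word_bounds[OF I W]
  unfolding potential_next_def assms
  by (elim conjE) (simp add: potential_def Let_def set_reg_def)

lemma potential_next_57:
  assumes "p = 57"
  shows "1 + potential_next B' p r A b \<le> potential B p r A"
  using I[unfolded assms inv_def, simplified] word_bounds[OF I W]
  unfolding potential_next_def assms
  by (elim conjE) (simp add: potential_def Let_def set_reg_def)

lemma potential_next:
  assumes "p \<notin> {9, 36, 53, 58}"
  shows "1 + potential_next B' p r A b \<le> potential B p r A"
proof -
  have "p \<in> {..<59}" using I by (simp add: inv_def)
  with assms show ?thesis
    unfolding lessThan_59 by (elim insertE emptyE)
      (erule
        potential_next_0 potential_next_1 potential_next_2 potential_next_3 potential_next_4
        potential_next_5 potential_next_6 potential_next_7 potential_next_8 potential_next_10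
        potential_next_11 potential_next_12 potential_next_13 potential_next_14
        potential_next_15 potential_next_16 potential_next_17 potential_next_18
        potential_next_19 potential_next_20 potential_next_21 potential_next_22
        potential_next_23 potential_next_24 potential_next_25 potential_next_26
        potential_next_27 potential_next_28 potential_next_29 potential_next_30
        potential_next_31 potential_next_32 potential_next_33 potential_next_34
        potential_next_35 potential_next_37 potential_next_38 potential_next_39
        potential_next_40 potential_next_41 potential_next_42 potential_next_43
        potential_next_44 potential_next_45 potential_next_46 potential_next_47
        potential_next_48 potential_next_49 potential_next_50 potential_next_51
        potential_next_52 potential_next_54 potential_next_55 potential_next_56
        potential_next_57 | simp)+
qed

end

context
  fixes \<alpha> p :: nat and r A B :: "nat \<Rightarrow> nat"
  assumes I: "inv \<alpha> p r A" and W: "words r A"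
begin

text \<open>Both outcomes are evaluated with the same \<open>B\<close>, so unfolding
  \<open>coin_mean\<close> once gives their average.\<close>

lemma potential_next_toss:
  assumes "p = 9"
  shows "1 + (potential_next B p r A True + potential_next B p r A False) / 2 \<le> potential B p r A"
proof -
  have "0 < r 6" using I[unfolded assms inv_def, simplified] by simp
  then show ?thesis
    unfolding potential_next_def assms using word_bounds(6)[OF I W]
    by (simp add: potential_def Let_def set_reg_def bits_half add_divide_distrib coin_mean.simps[of _ "r 6"])
qed

text \<open>The countdown is the same for either value of \<open>b\<close>; this makes the time of
  reading, and with it the memory read from, independent of the coins for the pivot.\<close>

lemma time_to_load_next:
  assumes "p \<in> {9, 10, 11, 12, 13, 14, 15}" "s = exec w b (prog ! p) \<lparr>pc = p, regs = r, mem = A\<rparr>"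
  shows "time_to_load p r = Suc (time_to_load (pc s) (regs s)) \<and> mem s = A"
proof -
  have "p = 9 \<Longrightarrow> 0 < r 6" using I by (simp add: inv_def)
  moreover have "p = 12 \<Longrightarrow> r 12 = 2 mod 2 ^ w" using I by (simp add: inv_def)
  moreover have "r 13 = 0" using I by (simp add: inv_def)
  moreover have "r 6 div (2 mod 2 ^ w) mod 2 ^ w = r 6 div 2"
    using word_bounds(1)[OF I W] by (rule word_half)
  ultimately show ?thesis
    using assms by (elim insertE emptyE) (auto simp: time_to_load_def set_reg_def bits_half)
qed

end

end

section \<open>Runs of the program\<close>

text \<open>The memory after the corruptions of the next \<open>d\<close> steps, provided these steps store nothing.\<close>

primrec future_mem :: "adversary \<Rightarrow> nat \<Rightarrow> nat \<Rightarrow> (nat \<Rightarrow> nat) \<Rightarrow> nat \<Rightarrow> nat" where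
  "future_mem adv t 0 A = A"
| "future_mem adv t (Suc d) A =
     future_mem adv (Suc t) d (\<lambda>a. case adv t a of None \<Rightarrow> A a | Some v \<Rightarrow> v)"

lemma prog_nth_Halt: "p < 59 \<Longrightarrow> prog ! p = Halt \<Longrightarrow> p \<in> {36, 53, 58}"
proof -
  assume "p < 59" and h: "prog ! p = Halt"
  then have "p \<in> {..<59}" by simp
  with h show ?thesis
    unfolding lessThan_59 by (elim insertE emptyE) simp_all
qed

lemma corrupt_simps [simp]:
  "pc (corrupt c s) = pc s" "regs (corrupt c s) = regs s"
  "mem (corrupt c s) = (\<lambda>a. case c a of None \<Rightarrow> mem s a | Some v \<Rightarrow> v)"
  by (simp_all add: corrupt_def)

context instance_of_selection begin

abbreviation good :: "nat \<Rightarrow> config \<Rightarrow> bool" where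
  "good \<alpha> s \<equiv> inv \<alpha> (pc s) (regs s) (mem s) \<and> words (regs s) (mem s)"

lemma inv_less_59: "inv \<alpha> p r A \<Longrightarrow> p < 59"
  by (simp add: inv_def)

lemma inv_result: "inv \<alpha> p r A \<Longrightarrow> p \<in> {36, 53, 58} \<Longrightarrow> near_rank \<alpha> X k (r 0)"
  by (elim insertE emptyE; hypsubst_thin; simp add: inv_def)

lemma inv_index:
  assumes "inv \<alpha> p r A"
  shows "p = 15 \<Longrightarrow> r 7 < n" "p = 23 \<Longrightarrow> r 6 < n" "p = 40 \<Longrightarrow> r 6 < n" "p = 46 \<Longrightarrow> r 7 < n"
  using assms by (hypsubst_thin, simp add: inv_def, (elim conjE, linarith)?)+

lemma halted_prog_iff:
  assumes "inv \<alpha> (pc s) r A"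
  shows "halted prog s \<longleftrightarrow> pc s \<in> {36, 53, 58}"
  using prog_nth_Halt[of "pc s"] inv_less_59[OF assms] by (auto simp: halted_def)

lemma good_mono:
  assumes "good \<alpha> s" "\<alpha> \<le> \<beta>"
  shows "good \<beta> s"
proof -
  have "inv (\<alpha> + card {..<\<beta> - \<alpha>}) (pc s) (regs s) (mem s)"
    using assms by (intro inv_perturb) auto
  with assms show ?thesis by simp
qed

lemma good_corrupt:
  assumes "good \<alpha> s" "finite (dom c)" "\<And>a v. c a = Some v \<Longrightarrow> v < 2 ^ w"
  shows "good (\<alpha> + card (dom c)) (corrupt c s)"
proof -
  have "inv (\<alpha> + card (dom c)) (pc s) (regs s) (mem (corrupt c s))"
    using assms by (intro inv_perturb[where A = "mem s"]) (auto split: option.splits)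
  moreover have "words (regs s) (mem (corrupt c s))"
    using assms by (auto simp: words_def split: option.splits)
  ultimately show ?thesis by simp
qed

lemma good_exec:
  assumes "good \<alpha> s" "\<not> halted prog s"
  shows "good \<alpha> (exec w b (prog ! pc s) s)"
proof -
  have "pc s \<notin> {36, 53, 58}" using assms halted_prog_iff by blast
  then have "inv_next \<alpha> (pc s) (regs s) (mem s) b"
    using assms inv_next by blast
  moreover have "\<lparr>pc = pc s, regs = regs s, mem = mem s\<rparr> = s" by simp
  ultimately show ?thesis
    using assms words_exec by (simp add: inv_next_def Let_def)
qed

lemma halted_corrupt [simp]: "halted P (corrupt c s) = halted P s"
  by (simp add: halted_def)

section \<open>Runs against a fixed adversary\<close>

context
  fixes \<delta> :: nat and adv :: adversary
  assumes adv: "valid_adversary w \<delta> adv"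
begin

lemma fin_events: "finite (corruption_events adv)"
  using adv by (simp add: valid_adversary_def)

abbreviation R :: "(nat \<Rightarrow> bool) \<Rightarrow> nat \<Rightarrow> config" where
  "R \<omega> t \<equiv> run w prog adv \<omega> (initial w n k \<delta> M) t"

lemma good_initial: "good 0 (initial w n k \<delta> M)"
proof -
  have "min \<delta> (2 ^ w - 1) < 2 ^ w" by (simp add: min_less_iff_disj)
  then show ?thesis
    using k n M by (simp add: inv_def initial_def words_def close_def rank_input_array)
qed

lemma good_corrupted:
  assumes "good \<alpha> s"
  shows "good (\<alpha> + corruptions adv t) (corrupt (adv t) s)"
  unfolding corruptions_def
  using adv by (intro good_corrupt assms finite_dom_adversary fin_events) (auto simp: valid_adversary_def)

lemma good_run: "good (\<Sum>t'<t. corruptions adv t') (R \<omega> t)"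
proof (induction t)
  case 0
  then show ?case using good_initial by simp
next
  case (Suc t)
  show ?case
  proof (cases "halted prog (R \<omega> t)")
    case True
    then show ?thesis using good_mono[OF Suc, of "\<Sum>t'<Suc t. corruptions adv t'"] by simp
  next
    case False
    have "good (\<Sum>t'<Suc t. corruptions adv t') (corrupt (adv t) (R \<omega> t))"
      using good_corrupted[OF Suc] by simp
    then have "good (\<Sum>t'<Suc t. corruptions adv t')
        (exec w (\<omega> t) (prog ! pc (corrupt (adv t) (R \<omega> t))) (corrupt (adv t) (R \<omega> t)))"
      using False by (intro good_exec) simp_all
    then show ?thesis using False by (simp add: Let_def)
  qed
qed

lemma result_correct:
  assumes "halted prog (R \<omega> t)"
  shows "selects (num_corruptions w prog adv (initial w n k \<delta> M) \<omega>) X k (regs (R \<omega> t) 0)"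
proof -
  \<comment> \<open>\<open>good_run\<close> adds up corruptions even after halting, whereas
    \<open>num_corruptions\<close> stops at the first halting time; so the invariant is taken at
    that time.\<close>
  define T where "T = (LEAST t. halted prog (R \<omega> t))"
  have T: "halted prog (R \<omega> T)"
    unfolding T_def by (rule LeastI) (rule assms)
  have before: "\<not> halted prog (R \<omega> t')" if "t' < T" for t'
    using that unfolding T_def by (rule not_less_Least)
  have "T \<le> t" using before[of t] assms not_less by blast
  then have "R \<omega> t = R \<omega> T" by (rule run_halted[OF T])
  moreover have "num_corruptions w prog adv (initial w n k \<delta> M) \<omega> = (\<Sum>t'<T. corruptions adv t')"
    using num_corruptions_halted[OF fin_events before T] by simp
  moreover have "pc (R \<omega> T) \<in> {36, 53, 58}"
    using T halted_prog_iff good_run[of T \<omega>] by blast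
  then have "near_rank (\<Sum>t'<T. corruptions adv t') X k (regs (R \<omega> T) 0)"
    using good_run[of T \<omega>] inv_result by blast
  ultimately show ?thesis using selects_if_near_rank by simp
qed

lemma accessed_in_array:
  assumes "\<not> halted prog (R \<omega> t)"
  shows "accessed (prog ! pc (R \<omega> t)) (R \<omega> t) \<subseteq> {..<n}"
proof -
  define s where "s = R \<omega> t"
  obtain \<alpha> where I: "inv \<alpha> (pc s) (regs s) (mem s)" using good_run[of t \<omega>] s_def by blast
  have "pc s \<in> {..<59}" using inv_less_59[OF I] by simp
  then have "accessed (prog ! pc s) s \<subseteq> {..<n}"
    unfolding lessThan_59 using inv_index[OF I]
    by (elim insertE emptyE) simp_all
  then show ?thesis by (simp add: s_def)
qed

text \<open>Time enters only through the coming moves of the adversary. Outside the choice of the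
  pivot \<open>potential\<close> ignores its first argument.\<close>

definition \<Phi> :: "nat \<Rightarrow> config \<Rightarrow> real" where
  "\<Phi> t s = potential (future_mem adv t (time_to_load (pc s) (regs s)) (mem s)) (pc s) (regs s) (mem s)"

lemma drift:
  fixes t :: nat
  assumes s: "good \<alpha> s" "\<not> halted prog s"
  defines "s' \<equiv> \<lambda>b. exec w b (prog ! pc s) (corrupt (adv t) s)"
  shows "1 + (\<Phi> (Suc t) (s' True) + \<Phi> (Suc t) (s' False)) / 2 \<le> \<Phi> t s + 1024 * corruptions adv t"
proof -
  define p r A where "p = pc s" and "r = regs s" and "A = mem (corrupt (adv t) s)"
  define \<beta> where "\<beta> = \<alpha> + corruptions adv t"
  have IW: "inv \<beta> p r A" "words r A"
    using good_corrupted[OF s(1), of t] by (simp_all add: p_def r_def A_def \<beta>_def)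
  have c: "corrupt (adv t) s = \<lparr>pc = p, regs = r, mem = A\<rparr>"
    by (simp add: p_def r_def A_def)
  have s': "s' b = exec w b (prog ! p) \<lparr>pc = p, regs = r, mem = A\<rparr>" for b
    unfolding s'_def c by (simp add: p_def)
  have p: "p \<notin> {36, 53, 58}"
    using s halted_prog_iff[of \<alpha> s "regs s" "mem s"] by (simp add: p_def)
  define d where "d = time_to_load p r"
  define B where "B = future_mem adv t d (mem s)"
  define B' where "B' b = future_mem adv (Suc t) (time_to_load (pc (s' b)) (regs (s' b))) (mem (s' b))" for b
  have \<Phi>_next: "\<Phi> (Suc t) (s' b) = potential_next (B' b) p r A b" for b
    by (simp add: \<Phi>_def potential_next_def Let_def B'_def s')
  have loading: "B' b = B" "p = 15 \<Longrightarrow> B = A" if "p \<in> {9, 10, 11, 12, 13, 14, 15}" for b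
  proof -
    have *: "d = Suc (time_to_load (pc (s' b)) (regs (s' b)))" "mem (s' b) = A"
      using time_to_load_next[OF IW that s'] by (simp_all add: d_def)
    then show "B' b = B" by (simp add: B_def B'_def A_def)
    show "B = A" if "p = 15"
    proof -
      \<comment> \<open>The countdown includes the \<open>Load\<close> itself, because corruptions
        at its time strike before it is executed.\<close>
      have "d = Suc 0" using that by (simp add: d_def time_to_load_def)
      then show ?thesis by (simp add: B_def A_def)
    qed
  qed
  \<comment> \<open>\<open>B\<close> already contains the corruptions of this step whenever the
    potential depends on it, so only the current memory changes.\<close>
  have "potential B p r A \<le> potential B p r (mem s) + 1024 * real (card (dom (adv t)))"
    by (rule potential_perturb)
      (auto simp: A_def finite_dom_adversary[OF fin_events] split: option.splits)
  also have "potential B p r (mem s) = \<Phi> t s"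
    by (simp add: \<Phi>_def B_def d_def p_def r_def)
  finally have perturb: "potential B p r A \<le> \<Phi> t s + 1024 * corruptions adv t"
    by (simp add: corruptions_def)
  show ?thesis
  proof (cases "p = 9")
    case True
    then show ?thesis
      using potential_next_toss[OF IW True, of B] perturb loading by (simp add: \<Phi>_next)
  next
    case False
    have "1 + potential_next (B' b) p r A b \<le> potential B p r A" for b
    proof (rule potential_next[OF IW])
      show "B' b = B" if "10 \<le> p" "p \<le> 14"
        using that by (intro loading) (simp, linarith)
    qed (use loading p False in simp_all)
    from this[of True] this[of False] perturb show ?thesis
      unfolding \<Phi>_next by (simp add: field_simps)
  qed
qed

lemma expected_time_le:
  "expected_time w prog adv (initial w n k \<delta> M)
     \<le> ennreal (real (1024 * n + 3 * w + 4)) + 1024 * expected_corruptions w prog adv (initial w n k \<delta> M)"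
proof -
  have "expected_time w prog adv (initial w n k \<delta> M)
      \<le> ennreal (\<Phi> 0 (initial w n k \<delta> M)) + of_nat 1024 * expected_corruptions w prog adv (initial w n k \<delta> M)"
  proof (rule expected_time_le_potential[OF fin_events])
    show "0 \<le> \<Phi> t (R \<omega> t)" for t \<omega>
      by (simp add: \<Phi>_def potential_nonneg)
    show "\<Phi> (Suc t) (R \<omega> t) \<le> \<Phi> t (R \<omega> t)" if "halted prog (R \<omega> t)" for t \<omega>
    proof -
      have "pc (R \<omega> t) \<in> {36, 53, 58}"
        using that good_run[of t \<omega>] halted_prog_iff by blast
      then show ?thesis by (elim insertE emptyE) (simp_all add: \<Phi>_def potential_def Let_def)
    qed
    show "let c = R \<omega> t; c' = \<lambda>b. exec w b (prog ! pc c) (corrupt (adv t) c) in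
        \<not> halted prog c \<longrightarrow> 1 + (\<Phi> (Suc t) (c' True) + \<Phi> (Suc t) (c' False)) / 2
          \<le> \<Phi> t c + real (1024 * corruptions adv t)" for t \<omega>
      using drift[OF good_run] by (simp add: Let_def)
  qed
  then show ?thesis
    by (simp add: \<Phi>_def potential_def Let_def initial_def)
qed

text \<open>The adversary has finitely many corruptions in total, so the bound on the expected time
  is finite.\<close>

lemma AE_halted: "AE \<omega> in coin_space. \<exists>t. halted prog (R \<omega> t)"
proof (rule AE_halts)
  interpret prob_space coin_space
    unfolding coin_space_def by (intro prob_space_PiM measure_pmf.prob_space_axioms)
  have "num_corruptions w prog adv s \<omega> \<le> card (corruption_events adv)" for s \<omega>
    unfolding num_corruptions_def by (intro card_mono fin_events) auto
  then have "expected_corruptions w prog adv (initial w n k \<delta> M)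
      \<le> (\<integral>\<^sup>+\<omega>. of_nat (card (corruption_events adv)) \<partial>coin_space)"
    unfolding expected_corruptions_def by (intro nn_integral_mono) simp
  also have "\<dots> < \<infinity>"
    by (simp add: emeasure_space_1 of_nat_less_top)
  finally have "ennreal (real (1024 * n + 3 * w + 4)) + 1024 * expected_corruptions w prog adv (initial w n k \<delta> M) < \<infinity>"
    by (simp add: ennreal_mult_less_top)
  then show "expected_time w prog adv (initial w n k \<delta> M) < \<infinity>"
    using expected_time_le by (rule le_less_trans[rotated])
qed

end

end

lemma word_length_linear:
  fixes w :: "nat \<Rightarrow> nat"
  assumes "(\<lambda>n. real (w n)) \<in> O(\<lambda>n. ln (real n))"
  obtains c where "\<And>n. 1 \<le> n \<Longrightarrow> w n \<le> c * n"
proof -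
  obtain c where c: "eventually (\<lambda>n. norm (real (w n)) \<le> c * norm (ln (real n))) at_top"
    using assms by (elim landau_o.bigE)
  then obtain N where N: "\<And>n. N \<le> n \<Longrightarrow> real (w n) \<le> c * \<bar>ln (real n)\<bar>"
    by (auto simp: eventually_at_top_linorder)
  \<comment> \<open>The logarithmic bound holds only from \<open>N\<close> on; the sum covers the
    finitely many shorter arrays.\<close>
  define K where "K = nat \<lceil>\<bar>c\<bar>\<rceil> + (\<Sum>n<N. w n)"
  have "w n \<le> K * n" if "1 \<le> n" for n
  proof (cases "n < N")
    case True
    then have "w n \<le> (\<Sum>n<N. w n)" by (intro member_le_sum) auto
    also have "\<dots> \<le> K * n" using that by (cases n) (simp_all add: K_def)
    finally show ?thesis .
  next
    case False
    have "real (w n) \<le> c * \<bar>ln (real n)\<bar>" using N False by simp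
    also have "\<dots> \<le> \<bar>c\<bar> * real n"
      using that ln_le_minus_one[of "real n"] by (intro mult_mono) auto
    also have "\<dots> \<le> real K * real n"
      by (intro mult_right_mono) (auto simp: K_def intro!: add_increasing2 sum_nonneg)
    finally show ?thesis by (simp flip: of_nat_mult)
  qed
  then show ?thesis by (rule that)
qed

theorem theorem5:
  fixes w :: "nat \<Rightarrow> nat"
  assumes word_length: "(\<lambda>n. real (w n)) \<in> \<Theta>(\<lambda>n. ln (real n))"
    and index_fits: "\<And>n. n < 2 ^ w n"
  shows "\<exists>P. resilient_selection w P \<and> in_place w P \<and>
           (\<exists>C::nat. \<forall>n k \<delta> M adv. valid_instance (w n) n k \<delta> M adv \<longrightarrow>
              expected_time (w n) P adv (initial (w n) n k \<delta> M)
                \<le> of_nat C * (of_nat n + expected_corruptions (w n) P adv (initial (w n) n k \<delta> M)))"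
proof (intro exI[of _ prog] conjI)
  have inst: "instance_of_selection (w n) n k M" "valid_adversary (w n) \<delta> adv" "1 \<le> n"
    if "valid_instance (w n) n k \<delta> M adv" for n k \<delta> M adv
    using that index_fits by (auto simp: valid_instance_def instance_of_selection_def)
  show "resilient_selection w prog"
    unfolding resilient_selection_def Let_def
    using instance_of_selection.AE_halted[OF inst(1,2)] instance_of_selection.result_correct[OF inst(1,2)]
    by blast
  show "in_place w prog"
    unfolding in_place_def Let_def
    using instance_of_selection.accessed_in_array[OF inst(1,2)]
    by (intro exI[of _ 0]) simp
  obtain c where c: "\<And>n. 1 \<le> n \<Longrightarrow> w n \<le> c * n"
    using word_length_linear bigthetaD1[OF word_length] by blast
  \<comment> \<open>\<open>3 * w n\<close> is at most \<open>3 * c * n\<close>, and the additive 4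
    is at most \<open>4 * n\<close> since \<open>n\<close> is positive.\<close>
  define C where "C = 1028 + 3 * c"
  have "expected_time (w n) prog adv (initial (w n) n k \<delta> M)
      \<le> of_nat C * (of_nat n + expected_corruptions (w n) prog adv (initial (w n) n k \<delta> M))"
    if v: "valid_instance (w n) n k \<delta> M adv" for n k \<delta> M adv
  proof -
    let ?E = "expected_corruptions (w n) prog adv (initial (w n) n k \<delta> M)"
    have "1024 * n + 3 * w n + 4 \<le> C * n"
      using c[OF inst(3)[OF v]] inst(3)[OF v] by (simp add: C_def algebra_simps)
    then have "real (1024 * n + 3 * w n + 4) \<le> real (C * n)" by (simp only: of_nat_le_iff)
    then have "ennreal (real (1024 * n + 3 * w n + 4)) \<le> ennreal (real (C * n))"
      by (rule ennreal_leI)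
    also have "\<dots> = of_nat C * of_nat n"
      by (metis ennreal_of_nat_eq_real_of_nat of_nat_mult)
    finally have "ennreal (real (1024 * n + 3 * w n + 4)) \<le> of_nat C * of_nat n" .
    moreover have "1024 * ?E \<le> of_nat C * ?E"
    proof (rule mult_right_mono)
      have "(of_nat 1024 :: ennreal) \<le> of_nat C" unfolding of_nat_le_iff by (simp add: C_def)
      then show "(1024 :: ennreal) \<le> of_nat C" by simp
    qed simp
    ultimately have "ennreal (real (1024 * n + 3 * w n + 4)) + 1024 * ?E \<le> of_nat C * (of_nat n + ?E)"
      unfolding distrib_left by (rule add_mono)
    then show ?thesis
      using instance_of_selection.expected_time_le[OF inst(1,2)[OF v]] by (rule order.trans[rotated])
  qed
  then show "\<exists>C::nat. \<forall>n k \<delta> M adv. valid_instance (w n) n k \<delta> M adv \<longrightarrow>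
      expected_time (w n) prog adv (initial (w n) n k \<delta> M)
        \<le> of_nat C * (of_nat n + expected_corruptions (w n) prog adv (initial (w n) n k \<delta> M))"
    by blast
qed

end
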